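(* Consider an optimal trajectory $(x,u)$ of the affine optimal control problem (P) together with its lift $p$ given by Pontryagin's Maximum Principle. Suppose the problem has intrinsic order $q$, let $t_c$ be a junction of a singular arc and a nonsingular arc of this trajectory, suppose that the matrix $B$ evaluated along the trajectory is nonsingular in a neighborhood of $t_c$, and that the control on the singular arc satisfies $|u_i(t)|<K(t)$ for $i=1,\dots,m$. If $q$ is even and $A(t_c)+K(t_c)B(t_c)v\neq 0$ for all $v\in\{-1,1\}^m$, where $A(t_c),B(t_c)$ denote $A,B$ evaluated at $(x(t_c),p(t_c))$, then the junction $t_c$ is not analytic.
   Context: Problem (P): minimize $\int_0^{T_f(u)} \big(f_0(x)+\sum_{i=1}^m g_{0i}(x)u_i\big)\,dt$ subject to $\dot x=f(x)+\sum_{i=1}^m g_i(x)u_i$, $x(0)=\mathcal A$, $x(T_f(u))=\mathcal B$ (given points of $\mathbb R^n$), where $u=(u_1,\dots,u_m):[0,T_f(u)]\to\mathbb R^m$ is measurable with $|u_i(t)|\le K(t)$ for all $t$ and $i$. The final time is free; $f,g_i$ are analytic vector fields on $\mathbb R^n$; $f_0,g_{0i}:\mathbb R^n\to\mathbb R$ are analytic; $K$ is analytic and strictly positive. Maximum Principle lift. Put $H_\lambda(x,p,u)=\langle p,f(x)+\sum_i g_i(x)u_i\rangle-\lambda\big(f_0(x)+\sum_i g_{0i}(x)u_i\big)$, $\lambda\in\{0,1\}$. Every optimal trajectory $(x,u)$ is considered with a lift $p(t)$ and $\lambda\in\{0,1\}$ such that $(\lambda,p(t))\ne0$ and, for almost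 all $t$, $\dot x=\partial H_\lambda/\partial p$, $\dot p=-\partial H_\lambda/\partial x$, $H_\lambda(x(t),p(t),u(t))=\max\{H_\lambda(x(t),p(t),w): |w_i|\le K(t)\}$, and $H_\lambda(x(t),p(t),u(t))=0$. Augmented notation. Add the coordinate $x_0$ with $\dot x_0=f_0(x)+\sum_i g_{0i}(x)u_i$, and from now on write $f,g_i,x,p$ for the augmented objects $(f_0,f)$, $(g_{0i},g_i)$, $(x_0,x)$, $(-\lambda,p)$ in dimension $n+1$, so that $H_\lambda=\langle p,f\rangle+\sum_i\langle p,g_i\rangle u_i$. Let $\phi_i=\langle p,g_i(x)\rangle$ and $\phi=(\phi_1,\dots,\phi_m)$, viewed along extremals. A singular interval (the trajectory restricted to it is a singular arc) is an interval on which all $\phi_i$ vanish. A nonsingular interval (nonsingular arc) is an interval on which all $\phi_i$ are nonzero almost everywhere; there the maximum condition gives $u_i(t)=\operatorname{sign}(\phi_i(t))K(t)$. A junction is a time $t_c$ which is the common endpoint of a singular interval and a nonsingular interval. Order. Differentiating $\phi$ repeatedly along extremals, let $k$ be the smallest integer such that $B_k:=\frac{\partial}{\partial u}\frac{d^k\phi}{dt^k}$ (an $m\times m$ matrix) is not identically zero as a function of $(x,p)$; then $\frac{d^k\phi}{dt^k}=A_k(x,p)+B_k(x,p)u$. The intrinsic order of the problem is $q=k/2$, assumed to be an integer; write $A=A_{2q}$, $B=B_{2q}$. The Generalized Legendre–Clebsch Condition (a result of Robbins, recalled by the paper as known) is in force: $(-1)^qB$ is negative semidefinite along singular arcs of optimal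 trajectories. A function is piecewise analytic on $(a,b)$ if for each $t_c\in(a,b)$ there are $t_1\in(a,t_c)$, $t_2\in(t_c,b)$ such that it is analytic on $(t_1,t_c)$ and on $(t_c,t_2)$ (componentwise for vector-valued maps). A junction is analytic if the optimal control is piecewise analytic in a neighborhood of it. *)

theory Defs
  imports "HOL-Analysis.Analysis"
begin

text \<open>
  Real analyticity: near every point of the set the function is the sum of a power series in the
  coordinates. A multi-index is a function from the basis to the naturals, extended by
  \<open>undefined\<close> off the basis so that each multi-index is counted once.
\<close>

definition real_analytic_at ::
    "('a::euclidean_space \<Rightarrow> 'b::real_normed_vector) \<Rightarrow> 'a \<Rightarrow> bool" where
  "real_analytic_at f a \<longleftrightarrow>
     (\<exists>r>0. \<exists>c :: ('a \<Rightarrow> nat) \<Rightarrow> 'b. \<forall>y\<in>ball a r.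
        ((\<lambda>\<alpha>. (\<Prod>b\<in>Basis. ((y - a) \<bullet> b) ^ \<alpha> b) *\<^sub>R c \<alpha>) has_sum f y) (Basis \<rightarrow>\<^sub>E UNIV))"

definition real_analytic_on ::
    "('a::euclidean_space \<Rightarrow> 'b::real_normed_vector) \<Rightarrow> 'a set \<Rightarrow> bool" where
  "real_analytic_on f S \<longleftrightarrow> (\<forall>a\<in>S. real_analytic_at f a)"

definition piecewise_analytic :: "(real \<Rightarrow> 'b::real_normed_vector) \<Rightarrow> real \<Rightarrow> real \<Rightarrow> bool" where
  "piecewise_analytic h a b \<longleftrightarrow>
     (\<forall>s\<in>{a<..<b}. \<exists>t1\<in>{a<..<s}. \<exists>t2\<in>{s<..<b}.
        real_analytic_on h {t1<..<s} \<and> real_analytic_on h {s<..<t2})"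

definition gradient :: "('a::euclidean_space \<Rightarrow> real) \<Rightarrow> 'a \<Rightarrow> 'a" where
  "gradient h z = (\<Sum>b\<in>Basis. frechet_derivative h (at z) b *\<^sub>R b)"

definition negative_semidefinite :: "real^'m^'m \<Rightarrow> bool" where
  "negative_semidefinite M \<longleftrightarrow> (\<forall>w. w \<bullet> (M *v w) \<le> 0)"

text \<open>
  \<open>x\<close> is absolutely continuous on \<open>[0,T]\<close> with derivative \<open>v\<close> almost everywhere (a Caratheodory
  solution), in the form of an indefinite Lebesgue integral.
\<close>

definition solves_ae :: "real \<Rightarrow> (real \<Rightarrow> 'a::euclidean_space) \<Rightarrow> (real \<Rightarrow> 'a) \<Rightarrow> bool" where
  "solves_ae T x v \<longleftrightarrow>
     v absolutely_integrable_on {0..T} \<and>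
     (\<forall>t\<in>{0..T}. (v has_integral (x t - x 0)) {0..t})"


subsection \<open>The control problem\<close>

record ('n, 'm) control_problem =
  cost_drift :: "real^'n \<Rightarrow> real"                   (* f_0 *)
  cost_ctrl  :: "'m \<Rightarrow> real^'n \<Rightarrow> real"             (* g_0i *)
  drift      :: "real^'n \<Rightarrow> real^'n"                (* f *)
  ctrl       :: "'m \<Rightarrow> real^'n \<Rightarrow> real^'n"          (* g_i *)
  bound      :: "real \<Rightarrow> real"                      (* K *)
  source     :: "real^'n"
  target     :: "real^'n"

text \<open>Times are nonnegative, so the bound \<open>K\<close> is only constrained on \<open>[0,\<infinity>)\<close>.\<close>

definition analytic_problem :: "('n::finite, 'm::finite) control_problem \<Rightarrow> bool" where
  "analytic_problem P \<longleftrightarrow>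
     real_analytic_on (cost_drift P) UNIV \<and> (\<forall>i. real_analytic_on (cost_ctrl P i) UNIV) \<and>
     real_analytic_on (drift P) UNIV \<and> (\<forall>i. real_analytic_on (ctrl P i) UNIV) \<and>
     real_analytic_on (bound P) {0..} \<and> (\<forall>t\<ge>0. 0 < bound P t)"

definition dynamics ::
    "('n::finite, 'm::finite) control_problem \<Rightarrow> real^'n \<Rightarrow> real^'m \<Rightarrow> real^'n" where
  "dynamics P x u = drift P x + (\<Sum>i\<in>UNIV. (u $ i) *\<^sub>R ctrl P i x)"

definition running_cost ::
    "('n::finite, 'm::finite) control_problem \<Rightarrow> real^'n \<Rightarrow> real^'m \<Rightarrow> real" where
  "running_cost P x u = cost_drift P x + (\<Sum>i\<in>UNIV. cost_ctrl P i x * u $ i)"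

definition admissible ::
    "('n::finite, 'm::finite) control_problem \<Rightarrow> real \<Rightarrow> (real \<Rightarrow> real^'n) \<Rightarrow> (real \<Rightarrow> real^'m) \<Rightarrow> bool"
  where
  "admissible P T x u \<longleftrightarrow>
     0 < T \<and> u \<in> borel_measurable (lebesgue_on {0..T}) \<and>
     (\<forall>t\<in>{0..T}. \<forall>i. \<bar>u t $ i\<bar> \<le> bound P t) \<and>
     solves_ae T x (\<lambda>t. dynamics P (x t) (u t)) \<and>
     x 0 = source P \<and> x T = target P"

text \<open>The value at \<open>t\<close> of the additional coordinate \<open>x\<^sub>0\<close>; at the final time it is the cost.\<close>

definition accumulated_cost ::
    "('n::finite, 'm::finite) control_problem \<Rightarrow> (real \<Rightarrow> real^'n) \<Rightarrow> (real \<Rightarrow> real^'m) \<Rightarrow> real \<Rightarrow> real"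
  where
  "accumulated_cost P x u t = integral {0..t} (\<lambda>s. running_cost P (x s) (u s))"

definition optimal ::
    "('n::finite, 'm::finite) control_problem \<Rightarrow> real \<Rightarrow> (real \<Rightarrow> real^'n) \<Rightarrow> (real \<Rightarrow> real^'m) \<Rightarrow> bool"
  where
  "optimal P T x u \<longleftrightarrow>
     admissible P T x u \<and>
     (\<forall>T' x' u'. admissible P T' x' u' \<longrightarrow>
        accumulated_cost P x u T \<le> accumulated_cost P x' u' T')"


subsection \<open>The Maximum Principle lift\<close>

definition hamiltonian ::
    "('n::finite, 'm::finite) control_problem \<Rightarrow> real \<Rightarrow> real^'n \<Rightarrow> real^'n \<Rightarrow> real^'m \<Rightarrow> real" where
  "hamiltonian P l x p u = p \<bullet> dynamics P x u - l * running_cost P x u"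

definition pmp_lift ::
    "('n::finite, 'm::finite) control_problem \<Rightarrow> real \<Rightarrow> (real \<Rightarrow> real^'n) \<Rightarrow> (real \<Rightarrow> real^'m) \<Rightarrow>
     real \<Rightarrow> (real \<Rightarrow> real^'n) \<Rightarrow> bool" where
  "pmp_lift P T x u l p \<longleftrightarrow>
     l \<in> {0, 1} \<and>
     (\<forall>t\<in>{0..T}. (l, p t) \<noteq> 0) \<and>
     solves_ae T x (\<lambda>t. gradient (\<lambda>p'. hamiltonian P l (x t) p' (u t)) (p t)) \<and>
     solves_ae T p (\<lambda>t. - gradient (\<lambda>x'. hamiltonian P l x' (p t) (u t)) (x t)) \<and>
     (AE t in lebesgue_on {0..T}.
        (\<forall>w. (\<forall>i. \<bar>w $ i\<bar> \<le> bound P t) \<longrightarrow>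
           hamiltonian P l (x t) (p t) w \<le> hamiltonian P l (x t) (p t) (u t))) \<and>
     (AE t in lebesgue_on {0..T}. hamiltonian P l (x t) (p t) (u t) = 0)"


subsection \<open>Augmented objects, order\<close>

type_synonym 'n aug = "real \<times> (real^'n)"

definition aug_drift ::
    "('n::finite, 'm::finite) control_problem \<Rightarrow> 'n aug \<Rightarrow> 'n aug" where
  "aug_drift P X = (cost_drift P (snd X), drift P (snd X))"

definition aug_ctrl ::
    "('n::finite, 'm::finite) control_problem \<Rightarrow> 'm \<Rightarrow> 'n aug \<Rightarrow> 'n aug" where
  "aug_ctrl P i X = (cost_ctrl P i (snd X), ctrl P i (snd X))"

definition aug_hamiltonian ::
    "('n::finite, 'm::finite) control_problem \<Rightarrow> real^'m \<Rightarrow> 'n aug \<times> 'n aug \<Rightarrow> real" where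
  "aug_hamiltonian P u = (\<lambda>(X, Q). Q \<bullet> aug_drift P X + (\<Sum>i\<in>UNIV. (Q \<bullet> aug_ctrl P i X) * u $ i))"

definition extremal_field ::
    "('n::finite, 'm::finite) control_problem \<Rightarrow> real^'m \<Rightarrow> 'n aug \<times> 'n aug \<Rightarrow> 'n aug \<times> 'n aug" where
  "extremal_field P u = (\<lambda>(X, Q).
     (gradient (\<lambda>Q'. aug_hamiltonian P u (X, Q')) Q,
      - gradient (\<lambda>X'. aug_hamiltonian P u (X', Q)) X))"

definition switching ::
    "('n::finite, 'm::finite) control_problem \<Rightarrow> 'n aug \<times> 'n aug \<Rightarrow> real^'m" where
  "switching P = (\<lambda>(X, Q). \<chi> i. Q \<bullet> aug_ctrl P i X)"

text \<open>
  The expression \<open>d\<^sup>k\<phi>/dt\<^sup>k\<close> as a function of the control value and of the augmented pair \<open>(x,p)\<close>.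
  The control is held fixed in the chain rule. This is the full time derivative as long as the
  lower derivatives do not depend on \<open>u\<close>, i.e. for all \<open>k\<close> up to the first one with \<open>B\<^sub>k\<close> not
  identically zero; up to that \<open>k\<close> it is moreover affine in \<open>u\<close>, so that \<open>A\<^sub>k\<close> is the value
  and \<open>B\<^sub>k\<close> the Jacobian at \<open>u = 0\<close>.
\<close>

primrec switching_deriv ::
    "('n::finite, 'm::finite) control_problem \<Rightarrow> nat \<Rightarrow> real^'m \<Rightarrow> 'n aug \<times> 'n aug \<Rightarrow> real^'m" where
  "switching_deriv P 0 u = switching P"
| "switching_deriv P (Suc k) u =
     (\<lambda>Z. frechet_derivative (switching_deriv P k u) (at Z) (extremal_field P u Z))"

definition A_coeff ::
    "('n::finite, 'm::finite) control_problem \<Rightarrow> nat \<Rightarrow> 'n aug \<times> 'n aug \<Rightarrow> real^'m" where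
  "A_coeff P k Z = switching_deriv P k 0 Z"

definition B_coeff ::
    "('n::finite, 'm::finite) control_problem \<Rightarrow> nat \<Rightarrow> 'n aug \<times> 'n aug \<Rightarrow> real^'m^'m" where
  "B_coeff P k Z = jacobian (\<lambda>u. switching_deriv P k u Z) (at 0)"

definition intrinsic_order :: "('n::finite, 'm::finite) control_problem \<Rightarrow> nat \<Rightarrow> bool" where
  "intrinsic_order P q \<longleftrightarrow>
     (\<exists>Z. B_coeff P (2 * q) Z \<noteq> 0) \<and> (\<forall>j<2 * q. \<forall>Z. B_coeff P j Z = 0)"


subsection \<open>Arcs and junctions\<close>

definition aug_lift ::
    "('n::finite, 'm::finite) control_problem \<Rightarrow> (real \<Rightarrow> real^'n) \<Rightarrow> (real \<Rightarrow> real^'m) \<Rightarrow>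
     real \<Rightarrow> (real \<Rightarrow> real^'n) \<Rightarrow> real \<Rightarrow> 'n aug \<times> 'n aug" where
  "aug_lift P x u l p t = ((accumulated_cost P x u t, x t), (- l, p t))"

text \<open>In the following \<open>Z\<close> is the augmented lift of a trajectory on \<open>[0,T]\<close>.\<close>

definition singular_interval ::
    "('n::finite, 'm::finite) control_problem \<Rightarrow> real \<Rightarrow> (real \<Rightarrow> 'n aug \<times> 'n aug) \<Rightarrow>
     real \<Rightarrow> real \<Rightarrow> bool" where
  "singular_interval P T Z a b \<longleftrightarrow>
     0 \<le> a \<and> a < b \<and> b \<le> T \<and> (\<forall>t\<in>{a<..<b}. \<forall>i. switching P (Z t) $ i = 0)"

definition nonsingular_interval ::
    "('n::finite, 'm::finite) control_problem \<Rightarrow> real \<Rightarrow> (real \<Rightarrow> 'n aug \<times> 'n aug) \<Rightarrow>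
     real \<Rightarrow> real \<Rightarrow> bool" where
  "nonsingular_interval P T Z a b \<longleftrightarrow>
     0 \<le> a \<and> a < b \<and> b \<le> T \<and>
     (\<forall>i. AE t in lebesgue_on {a<..<b}. switching P (Z t) $ i \<noteq> 0)"

definition junction ::
    "('n::finite, 'm::finite) control_problem \<Rightarrow> real \<Rightarrow> (real \<Rightarrow> 'n aug \<times> 'n aug) \<Rightarrow>
     real \<Rightarrow> real \<Rightarrow> real \<Rightarrow> real \<Rightarrow> real \<Rightarrow> bool" where
  "junction P T Z s1 s2 n1 n2 tc \<longleftrightarrow>
     singular_interval P T Z s1 s2 \<and> nonsingular_interval P T Z n1 n2 \<and>
     tc \<in> {s1, s2} \<and> tc \<in> {n1, n2}"

definition legendre_clebsch ::
    "('n::finite, 'm::finite) control_problem \<Rightarrow> nat \<Rightarrow> real \<Rightarrow> (real \<Rightarrow> 'n aug \<times> 'n aug) \<Rightarrow> bool" where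
  "legendre_clebsch P q T Z \<longleftrightarrow>
     (\<forall>a b. singular_interval P T Z a b \<longrightarrow>
        (\<forall>t\<in>{a<..<b}. negative_semidefinite ((-1) ^ q *\<^sub>R B_coeff P (2 * q) (Z t))))"

definition analytic_junction :: "real \<Rightarrow> (real \<Rightarrow> real^'m) \<Rightarrow> real \<Rightarrow> bool" where
  "analytic_junction T u tc \<longleftrightarrow>
     (\<exists>a b. 0 \<le> a \<and> a < tc \<and> tc < b \<and> b \<le> T \<and> piecewise_analytic u a b)"

end

theory Submission
  imports Defs
begin

text \<open>
  Suppose the junction is analytic. On the nonsingular side every \<open>u\<^sub>i / K\<close> is then continuous with
  values \<open>\<plusminus>1\<close>, so \<open>u = K v\<close> for a fixed sign vector \<open>v\<close>, and \<open>d\<^sup>2\<^sup>q\<phi>/dt\<^sup>2\<^sup>q\<close> tends at \<open>t\<^sub>c\<close> to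
  \<open>w = A + K B v\<close>. The lower derivatives of \<open>\<phi>\<close> do not involve \<open>u\<close>; they vanish on the singular
  side and hence at \<open>t\<^sub>c\<close>. By Taylor expansion \<open>\<phi>\<^sub>i\<close> behaves like \<open>w\<^sub>i (t - t\<^sub>c)\<^sup>2\<^sup>q / (2q)!\<close>, and the
  maximum condition gives \<open>v\<^sub>i \<phi>\<^sub>i \<ge> 0\<close>, so \<open>v\<^sub>i w\<^sub>i \<ge> 0\<close>. A limit point \<open>u\<^sub>s\<close> of the singular control
  satisfies \<open>A + B u\<^sub>s = 0\<close> and \<open>\<bar>u\<^sub>s\<^sub>i\<bar> \<le> K\<close>. With \<open>d = K v - u\<^sub>s\<close> we get \<open>w = B d\<close> and
  \<open>v\<^sub>i d\<^sub>i \<ge> 0\<close>, hence \<open>d \<bullet> B d \<ge> 0\<close>. For even \<open>q\<close> the Legendre-Clebsch condition says that \<open>B\<close> is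
  negative semidefinite; since \<open>B\<close> is moreover symmetric, \<open>w = B d = 0\<close>.

  Symmetry is essential, as \<open>u\<^sub>s\<close> may lie on the boundary of the cube. It holds because the entries of
  \<open>B\<close> are the Poisson brackets \<open>{H\<^sub>j, ad\<^sup>2\<^sup>q\<^sup>-\<^sup>1 H\<^sub>i}\<close>, \<open>ad = {H\<^sub>0, \<cdot>}\<close>, and all shorter brackets of
  this kind vanish.
\<close>

subsection \<open>Smooth functions\<close>

text \<open>The direction comes before the point, so that \<open>dirderiv f v\<close> is again a
  real function on the same space and can be differentiated again with the direction held
  constant.\<close>

definition dirderiv :: "('a::euclidean_space \<Rightarrow> real) \<Rightarrow> 'a \<Rightarrow> 'a \<Rightarrow> real" where
  "dirderiv f v x = frechet_derivative f (at x) v"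

text \<open>This encodes infinite differentiability without counting orders: differentiability at
  every stage forces all iterated derivatives to be continuous. Closure properties follow by
  exhibiting a class of functions that is stable under differentiation.\<close>

coinductive smooth :: "('a::euclidean_space \<Rightarrow> real) \<Rightarrow> bool" where
  "(\<And>x. f differentiable (at x)) \<Longrightarrow> (\<And>v. smooth (dirderiv f v)) \<Longrightarrow> smooth f"

lemma dirderiv_eqI: "(f has_derivative f') (at x) \<Longrightarrow> dirderiv f v x = f' v"
  unfolding dirderiv_def using frechet_derivative_at by metis

lemma has_derivative_dirderiv:
  "f differentiable (at x) \<Longrightarrow> (f has_derivative (\<lambda>v. dirderiv f v x)) (at x)"
  unfolding dirderiv_def using frechet_derivative_works by auto

lemma smooth_differentiable: "smooth f \<Longrightarrow> f differentiable (at x)"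
  by (auto elim: smooth.cases)

lemma smooth_dirderiv: "smooth f \<Longrightarrow> smooth (dirderiv f v)"
  by (auto elim: smooth.cases)

lemma smooth_has_derivative: "smooth f \<Longrightarrow> (f has_derivative (\<lambda>v. dirderiv f v x)) (at x)"
  by (simp add: has_derivative_dirderiv smooth_differentiable)

lemma smooth_isCont: "smooth f \<Longrightarrow> isCont f x"
  by (simp add: differentiable_imp_continuous_within smooth_differentiable)

lemma linear_dirderiv: "smooth f \<Longrightarrow> linear (\<lambda>v. dirderiv f v x)"
  using smooth_has_derivative has_derivative_linear by blast

lemma dirderiv_const [simp]: "dirderiv (\<lambda>_. c) v = (\<lambda>_. 0)"
  by (rule ext, rule dirderiv_eqI[OF has_derivative_const])

lemma dirderiv_add:
  "smooth f \<Longrightarrow> smooth g \<Longrightarrow> dirderiv (\<lambda>x. f x + g x) v = (\<lambda>x. dirderiv f v x + dirderiv g v x)"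
  by (rule ext, rule dirderiv_eqI[OF has_derivative_add[OF smooth_has_derivative smooth_has_derivative]])

lemma dirderiv_mult:
  "smooth f \<Longrightarrow> smooth g \<Longrightarrow>
     dirderiv (\<lambda>x. f x * g x) v = (\<lambda>x. f x * dirderiv g v x + dirderiv f v x * g x)"
  by (rule ext, rule dirderiv_eqI[OF has_derivative_mult[OF smooth_has_derivative smooth_has_derivative]])

lemma dirderiv_linear: "linear f \<Longrightarrow> dirderiv f v = (\<lambda>_. f v)"
  by (rule ext, rule dirderiv_eqI[OF linear_imp_has_derivative])

lemma dirderiv_comp_linear:
  fixes g :: "'b::euclidean_space \<Rightarrow> real"
  assumes "smooth g" "linear L"
  shows "dirderiv (\<lambda>x. g (L x)) v = (\<lambda>x. dirderiv g (L v) (L x))"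
  by (rule ext, rule dirderiv_eqI[OF has_derivative_compose[OF linear_imp_has_derivative[OF assms(2)]
        smooth_has_derivative[OF assms(1)]]])

lemma smooth_const [simp]: "smooth (\<lambda>_. c)"
proof (coinduction arbitrary: c)
  case (smooth c)
  have "\<exists>c'. dirderiv (\<lambda>_. c) v = (\<lambda>_. c')" for v :: 'a by auto
  then show ?case by auto
qed

text \<open>Sums and products of smooth functions are smooth by coinduction up to the ring operations.\<close>

inductive ring_closure :: "('a::euclidean_space \<Rightarrow> real) \<Rightarrow> bool" where
  base: "smooth f \<Longrightarrow> ring_closure f"
| add: "ring_closure f \<Longrightarrow> ring_closure g \<Longrightarrow> ring_closure (\<lambda>x. f x + g x)"
| mult: "ring_closure f \<Longrightarrow> ring_closure g \<Longrightarrow> ring_closure (\<lambda>x. f x * g x)"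

lemma ring_closure_dirderiv:
  "ring_closure f \<Longrightarrow> (\<forall>x. f differentiable (at x)) \<and> (\<forall>v. ring_closure (dirderiv f v))"
proof (induction rule: ring_closure.induct)
  case (base f)
  then show ?case by (auto intro: ring_closure.base smooth_differentiable smooth_dirderiv)
next
  case (add f g)
  have "dirderiv (\<lambda>x. f x + g x) v = (\<lambda>x. dirderiv f v x + dirderiv g v x)" for v
    by (rule ext, rule dirderiv_eqI[OF has_derivative_add[OF has_derivative_dirderiv has_derivative_dirderiv]])
       (use add in auto)
  then show ?case using add by (simp add: ring_closure.add)
next
  case (mult f g)
  have "dirderiv (\<lambda>x. f x * g x) v = (\<lambda>x. f x * dirderiv g v x + dirderiv f v x * g x)" for v
    by (rule ext, rule dirderiv_eqI[OF has_derivative_mult[OF has_derivative_dirderiv has_derivative_dirderiv]])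
       (use mult in auto)
  then show ?case using mult by (simp add: ring_closure.add ring_closure.mult)
qed

lemma ring_closure_smooth:
  assumes "ring_closure f"
  shows "smooth f"
proof (rule smooth.coinduct[of ring_closure, OF assms])
  fix g :: "'a \<Rightarrow> real"
  assume "ring_closure g"
  from ring_closure_dirderiv[OF this]
  show "\<exists>h. g = h \<and> (\<forall>x. h differentiable at x) \<and> (\<forall>v. ring_closure (dirderiv h v) \<or> smooth (dirderiv h v))"
    by (intro exI[of _ g]) simp
qed

lemma smooth_add: "smooth f \<Longrightarrow> smooth g \<Longrightarrow> smooth (\<lambda>x. f x + g x)"
  by (rule ring_closure_smooth, rule ring_closure.add) (rule ring_closure.base, assumption)+

lemma smooth_mult: "smooth f \<Longrightarrow> smooth g \<Longrightarrow> smooth (\<lambda>x. f x * g x)"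
  by (rule ring_closure_smooth, rule ring_closure.mult) (rule ring_closure.base, assumption)+

lemma smooth_sum: "(\<And>i. i \<in> I \<Longrightarrow> smooth (f i)) \<Longrightarrow> smooth (\<lambda>x. \<Sum>i\<in>I. f i x)"
  by (induction I rule: infinite_finite_induct) (simp_all add: smooth_add)

lemma smooth_linear: "linear f \<Longrightarrow> smooth f"
  by (rule smooth.intros) (auto simp: dirderiv_linear intro: linear_imp_differentiable)

text \<open>By the chain rule a derivative of g o L in direction v is
  \<open>dirderiv g (L v)\<close> composed with L, so the class of such composites is stable under
  differentiation.\<close>

lemma smooth_comp_linear:
  fixes g :: "'b::euclidean_space \<Rightarrow> real" and L :: "'a::euclidean_space \<Rightarrow> 'b"
  assumes "smooth g" "linear L"
  shows "smooth (\<lambda>x. g (L x))"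
  using assms(1)
proof (coinduction arbitrary: g)
  case (smooth g)
  have "(\<lambda>x. g (L x)) differentiable (at x)" for x
    using has_derivative_compose[OF linear_imp_has_derivative[OF assms(2)] smooth_has_derivative[OF smooth]]
    unfolding differentiable_def by blast
  moreover have "\<exists>g'. dirderiv (\<lambda>x. g (L x)) v = (\<lambda>x. g' (L x)) \<and> smooth g'" for v
    using dirderiv_comp_linear[OF smooth assms(2)] smooth_dirderiv[OF smooth] by blast
  ultimately show ?case by blast
qed

lemma smooth_diff: "smooth f \<Longrightarrow> smooth g \<Longrightarrow> smooth (\<lambda>x. f x - g x)"
  using smooth_add[of f "\<lambda>x. (-1) * g x"] smooth_mult[of "\<lambda>_. -1" g] by simp

lemma dirderiv_diff:
  "smooth f \<Longrightarrow> smooth g \<Longrightarrow> dirderiv (\<lambda>x. f x - g x) v = (\<lambda>x. dirderiv f v x - dirderiv g v x)"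
  by (rule ext, rule dirderiv_eqI[OF has_derivative_diff[OF smooth_has_derivative smooth_has_derivative]])

lemma dirderiv_sum:
  "(\<And>i. i \<in> I \<Longrightarrow> smooth (f i)) \<Longrightarrow> dirderiv (\<lambda>x. \<Sum>i\<in>I. f i x) v = (\<lambda>x. \<Sum>i\<in>I. dirderiv (f i) v x)"
  by (rule ext, rule dirderiv_eqI[OF has_derivative_sum[OF smooth_has_derivative]])

section \<open>Symmetry of second derivatives\<close>

lemma smooth_line_derivative:
  assumes "smooth f"
  shows "((\<lambda>s. f (y + s *\<^sub>R v)) has_real_derivative dirderiv f v (y + s *\<^sub>R v)) (at s)"
proof -
  have "((\<lambda>s. y + s *\<^sub>R v) has_derivative (\<lambda>h. h *\<^sub>R v)) (at s)"
    by (auto intro!: derivative_eq_intros)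
  from has_derivative_compose[OF this smooth_has_derivative[OF assms]]
  have *: "((\<lambda>s. f (y + s *\<^sub>R v)) has_derivative (\<lambda>h. dirderiv f (h *\<^sub>R v) (y + s *\<^sub>R v))) (at s)" .
  have "(\<lambda>h. dirderiv f (h *\<^sub>R v) (y + s *\<^sub>R v)) = (*) (dirderiv f v (y + s *\<^sub>R v))"
    using linear_scale[OF linear_dirderiv[OF assms], of _ v "y + s *\<^sub>R v"] by (auto simp: mult.commute)
  with * show ?thesis
    by (simp add: has_field_derivative_def)
qed

text \<open>The mean value theorem is used twice: along v for the increment of f in direction w,
  then along w for \<open>dirderiv f v\<close>.\<close>

lemma second_difference_mean_value:
  assumes f: "smooth f" and "h > 0"
  shows "\<exists>\<xi>\<in>{0..h}. \<exists>\<eta>\<in>{0..h}.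
           f (x + h *\<^sub>R v + h *\<^sub>R w) - f (x + h *\<^sub>R v) - f (x + h *\<^sub>R w) + f x
             = h * h * dirderiv (dirderiv f v) w (x + \<xi> *\<^sub>R v + \<eta> *\<^sub>R w)"
proof -
  have "\<exists>\<xi>. 0 < \<xi> \<and> \<xi> < h \<and>
      (f (x + h *\<^sub>R w + h *\<^sub>R v) - f (x + h *\<^sub>R v)) - (f (x + h *\<^sub>R w + 0 *\<^sub>R v) - f (x + 0 *\<^sub>R v))
      = (h - 0) * (dirderiv f v (x + h *\<^sub>R w + \<xi> *\<^sub>R v) - dirderiv f v (x + \<xi> *\<^sub>R v))"
    by (rule MVT2[OF \<open>h > 0\<close>, of "\<lambda>s. f (x + h *\<^sub>R w + s *\<^sub>R v) - f (x + s *\<^sub>R v)"])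
       (intro DERIV_diff smooth_line_derivative[OF f])
  then obtain \<xi> where \<xi>: "0 < \<xi>" "\<xi> < h"
    and 1: "(f (x + h *\<^sub>R w + h *\<^sub>R v) - f (x + h *\<^sub>R v)) - (f (x + h *\<^sub>R w + 0 *\<^sub>R v) - f (x + 0 *\<^sub>R v))
      = (h - 0) * (dirderiv f v (x + h *\<^sub>R w + \<xi> *\<^sub>R v) - dirderiv f v (x + \<xi> *\<^sub>R v))"
    by blast
  have "\<exists>\<eta>. 0 < \<eta> \<and> \<eta> < h \<and>
      dirderiv f v (x + \<xi> *\<^sub>R v + h *\<^sub>R w) - dirderiv f v (x + \<xi> *\<^sub>R v + 0 *\<^sub>R w)
      = (h - 0) * dirderiv (dirderiv f v) w (x + \<xi> *\<^sub>R v + \<eta> *\<^sub>R w)"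
    by (rule MVT2[OF \<open>h > 0\<close>, of "\<lambda>s. dirderiv f v (x + \<xi> *\<^sub>R v + s *\<^sub>R w)"])
       (intro smooth_line_derivative[OF smooth_dirderiv[OF f]])
  then obtain \<eta> where \<eta>: "0 < \<eta>" "\<eta> < h"
    and 2: "dirderiv f v (x + \<xi> *\<^sub>R v + h *\<^sub>R w) - dirderiv f v (x + \<xi> *\<^sub>R v + 0 *\<^sub>R w)
      = (h - 0) * dirderiv (dirderiv f v) w (x + \<xi> *\<^sub>R v + \<eta> *\<^sub>R w)"
    by blast
  have "f (x + h *\<^sub>R v + h *\<^sub>R w) - f (x + h *\<^sub>R v) - f (x + h *\<^sub>R w) + f x
    = h * (dirderiv f v (x + \<xi> *\<^sub>R v + h *\<^sub>R w) - dirderiv f v (x + \<xi> *\<^sub>R v))"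
    using 1 by (simp add: add_ac)
  also have "\<dots> = h * h * dirderiv (dirderiv f v) w (x + \<xi> *\<^sub>R v + \<eta> *\<^sub>R w)"
    using 2 by simp
  finally show ?thesis using \<xi> \<eta> by force
qed

text \<open>The second difference is symmetric in v and w, so for each h the two mixed derivatives
  agree at two points that approach x as h tends to 0. Continuity of both derivatives gives equality
  at x.\<close>

lemma dirderiv_commute:
  assumes f: "smooth f"
  shows "dirderiv (dirderiv f v) w x = dirderiv (dirderiv f w) v x"
proof -
  define h where "h n = inverse (real (Suc n))" for n
  have h: "h n > 0" for n by (simp add: h_def)
  have h0: "h \<longlonglongrightarrow> 0" unfolding h_def by (rule LIMSEQ_inverse_real_of_nat)
  have "\<forall>n. \<exists>\<xi> \<eta> \<xi>' \<eta>'. \<xi> \<in> {0..h n} \<and> \<eta> \<in> {0..h n} \<and> \<xi>' \<in> {0..h n} \<and> \<eta>' \<in> {0..h n} \<and>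
      dirderiv (dirderiv f v) w (x + \<xi> *\<^sub>R v + \<eta> *\<^sub>R w) = dirderiv (dirderiv f w) v (x + \<xi>' *\<^sub>R w + \<eta>' *\<^sub>R v)"
  proof
    fix n
    obtain \<xi> \<eta> where A: "\<xi> \<in> {0..h n}" "\<eta> \<in> {0..h n}"
      "f (x + h n *\<^sub>R v + h n *\<^sub>R w) - f (x + h n *\<^sub>R v) - f (x + h n *\<^sub>R w) + f x
        = h n * h n * dirderiv (dirderiv f v) w (x + \<xi> *\<^sub>R v + \<eta> *\<^sub>R w)"
      using second_difference_mean_value[OF f h[of n]] by blast
    obtain \<xi>' \<eta>' where B: "\<xi>' \<in> {0..h n}" "\<eta>' \<in> {0..h n}"
      "f (x + h n *\<^sub>R w + h n *\<^sub>R v) - f (x + h n *\<^sub>R w) - f (x + h n *\<^sub>R v) + f x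
        = h n * h n * dirderiv (dirderiv f w) v (x + \<xi>' *\<^sub>R w + \<eta>' *\<^sub>R v)"
      using second_difference_mean_value[OF f h[of n]] by blast
    have "h n * h n * dirderiv (dirderiv f v) w (x + \<xi> *\<^sub>R v + \<eta> *\<^sub>R w)
      = h n * h n * dirderiv (dirderiv f w) v (x + \<xi>' *\<^sub>R w + \<eta>' *\<^sub>R v)"
      using A(3) B(3) by (simp add: add.commute add.left_commute diff_diff_eq)
    then have "dirderiv (dirderiv f v) w (x + \<xi> *\<^sub>R v + \<eta> *\<^sub>R w)
      = dirderiv (dirderiv f w) v (x + \<xi>' *\<^sub>R w + \<eta>' *\<^sub>R v)"
      using h[of n] by simp
    then show "\<exists>\<xi> \<eta> \<xi>' \<eta>'. \<xi> \<in> {0..h n} \<and> \<eta> \<in> {0..h n} \<and> \<xi>' \<in> {0..h n} \<and> \<eta>' \<in> {0..h n} \<and>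
      dirderiv (dirderiv f v) w (x + \<xi> *\<^sub>R v + \<eta> *\<^sub>R w) = dirderiv (dirderiv f w) v (x + \<xi>' *\<^sub>R w + \<eta>' *\<^sub>R v)"
      using A(1,2) B(1,2) by blast
  qed
  then obtain \<xi> \<eta> \<xi>' \<eta>' where I: "\<And>n. \<xi> n \<in> {0..h n}" "\<And>n. \<eta> n \<in> {0..h n}"
    "\<And>n. \<xi>' n \<in> {0..h n}" "\<And>n. \<eta>' n \<in> {0..h n}"
    and eq: "\<And>n. dirderiv (dirderiv f v) w (x + \<xi> n *\<^sub>R v + \<eta> n *\<^sub>R w)
      = dirderiv (dirderiv f w) v (x + \<xi>' n *\<^sub>R w + \<eta>' n *\<^sub>R v)"
    by metis
  have lim0: "z \<longlonglongrightarrow> 0" if "\<And>n. z n \<in> {0..h n}" for z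
    by (rule tendsto_sandwich[OF _ _ tendsto_const h0]) (use that in auto)
  have lim: "(\<lambda>n. g (x + z n *\<^sub>R a + z' n *\<^sub>R b)) \<longlonglongrightarrow> g x"
    if "smooth g" "\<And>n. z n \<in> {0..h n}" "\<And>n. z' n \<in> {0..h n}" for g z z' a b
  proof -
    have "(\<lambda>n. x + z n *\<^sub>R a + z' n *\<^sub>R b) \<longlonglongrightarrow> x + 0 *\<^sub>R a + 0 *\<^sub>R b"
      by (intro tendsto_intros lim0 that)
    then show ?thesis
      using isCont_tendsto_compose[OF smooth_isCont[OF that(1)]] by simp
  qed
  have "(\<lambda>n. dirderiv (dirderiv f v) w (x + \<xi> n *\<^sub>R v + \<eta> n *\<^sub>R w)) \<longlonglongrightarrow> dirderiv (dirderiv f v) w x"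
    by (intro lim smooth_dirderiv f I)
  moreover have "(\<lambda>n. dirderiv (dirderiv f v) w (x + \<xi> n *\<^sub>R v + \<eta> n *\<^sub>R w)) \<longlonglongrightarrow> dirderiv (dirderiv f w) v x"
    unfolding eq by (intro lim smooth_dirderiv f I)
  ultimately show ?thesis by (rule LIMSEQ_unique)
qed

subsection \<open>Real analytic functions are smooth\<close>

lemma has_sum_finite_sum:
  fixes f :: "'i \<Rightarrow> 'a \<Rightarrow> 'b::topological_comm_monoid_add"
  assumes "finite B" "\<And>b. b \<in> B \<Longrightarrow> (f b has_sum s b) A"
  shows "((\<lambda>x. \<Sum>b\<in>B. f b x) has_sum (\<Sum>b\<in>B. s b)) A"
  using assms by (induction B rule: finite_induct) (auto intro!: has_sum_add)

text \<open>The partial derivative along b of the monomial with exponent \<alpha>. The truncated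
  subtraction for \<open>\<alpha> b = 0\<close> is harmless, as the leading factor is then
  0.\<close>

definition monom_deriv :: "'a::euclidean_space \<Rightarrow> ('a \<Rightarrow> nat) \<Rightarrow> 'a \<Rightarrow> real" where
  "monom_deriv b \<alpha> y = of_nat (\<alpha> b) * (y \<bullet> b) ^ (\<alpha> b - 1) * (\<Prod>b'\<in>Basis - {b}. (y \<bullet> b') ^ \<alpha> b')"

lemma has_derivative_monom:
  fixes a :: "'a::euclidean_space"
  shows "((\<lambda>y. \<Prod>b\<in>Basis. ((y - a) \<bullet> b) ^ \<alpha> b) has_derivative
          (\<lambda>h. \<Sum>b\<in>Basis. (h \<bullet> b) * monom_deriv b \<alpha> (y - a))) (at y)"
  unfolding monom_deriv_def
  by (rule has_derivative_eq_rhs, rule has_derivative_prod)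
     (auto intro!: derivative_eq_intros sum.cong simp: mult_ac)

text \<open>Restricting to half the radius R gains a factor 2^N, where N is the total degree, and
  this absorbs the exponent that differentiation brings down. The bound compares the derivative with
  the value of the monomial where all coordinates equal R.\<close>

lemma monom_deriv_bound:
  fixes z :: "'a::euclidean_space"
  assumes b: "b \<in> Basis" and R: "0 < R" and z: "\<And>b. b \<in> Basis \<Longrightarrow> \<bar>z \<bullet> b\<bar> \<le> R / 2"
  shows "\<bar>monom_deriv b \<alpha> z\<bar> \<le> R ^ (\<Sum>b\<in>Basis. \<alpha> b) * (2 / R)"
proof (cases "\<alpha> b = 0")
  case True
  then show ?thesis using R by (simp add: monom_deriv_def)
next
  case False
  define N where "N = (\<Sum>b\<in>Basis. \<alpha> b)"
  have zpow: "\<bar>z \<bullet> b\<bar> ^ n \<le> (R / 2) ^ n" if "b \<in> Basis" for b n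
    using z[OF that] by (intro power_mono) auto
  have "\<bar>monom_deriv b \<alpha> z\<bar>
      = of_nat (\<alpha> b) * (\<bar>z \<bullet> b\<bar> ^ (\<alpha> b - 1) * (\<Prod>b'\<in>Basis - {b}. \<bar>z \<bullet> b'\<bar> ^ \<alpha> b'))"
    by (simp add: monom_deriv_def abs_mult abs_prod power_abs)
  also have "\<dots> \<le> of_nat (\<alpha> b) * ((R / 2) ^ (\<alpha> b - 1) * (\<Prod>b'\<in>Basis - {b}. (R / 2) ^ \<alpha> b'))"
    by (intro mult_left_mono mult_mono prod_mono prod_nonneg conjI zpow) (use b R in auto)
  also have "\<dots> = of_nat (\<alpha> b) * ((R / 2) ^ (\<alpha> b) * (\<Prod>b'\<in>Basis - {b}. (R / 2) ^ \<alpha> b')) * (2 / R)"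
    using False R by (cases "\<alpha> b") auto
  also have "(R / 2) ^ (\<alpha> b) * (\<Prod>b'\<in>Basis - {b}. (R / 2) ^ \<alpha> b') = (R / 2) ^ N"
    using b by (simp add: N_def power_sum prod.remove)
  also have "of_nat (\<alpha> b) * (R / 2) ^ N * (2 / R) \<le> R ^ N * (2 / R)"
  proof -
    have "\<alpha> b \<le> N" unfolding N_def using b by (intro member_le_sum) auto
    \<comment> \<open>Here N < 2^N is the inequality that trades the exponent for the halved
      radius.\<close>
    then have "\<alpha> b \<le> 2 ^ N" using less_exp[of N] by linarith
    then have "real (\<alpha> b) \<le> 2 ^ N" by (metis of_nat_le_iff of_nat_numeral of_nat_power)
    then have "real (\<alpha> b) * (R / 2) ^ N \<le> 2 ^ N * (R / 2) ^ N"
      using R by (intro mult_right_mono) auto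
    also have "\<dots> = R ^ N" by (simp add: power_mult_distrib[symmetric])
    finally show ?thesis using R by (intro mult_right_mono) auto
  qed
  finally show ?thesis by (simp add: N_def)
qed

lemma monom_deriv_Suc:
  assumes "b \<in> Basis"
  shows "monom_deriv b (\<beta>(b := Suc (\<beta> b))) y = real (Suc (\<beta> b)) * (\<Prod>b'\<in>Basis. (y \<bullet> b') ^ \<beta> b')"
proof -
  have "(\<Prod>b'\<in>Basis - {b}. (y \<bullet> b') ^ (\<beta>(b := Suc (\<beta> b))) b') = (\<Prod>b'\<in>Basis - {b}. (y \<bullet> b') ^ \<beta> b')"
    by (intro prod.cong) auto
  then show ?thesis
    using assms by (simp add: monom_deriv_def prod.remove[of Basis b])
qed

text \<open>Raising the exponent of b by one is a bijection onto the multi-indices with nonzero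
  b-entry; the remaining terms vanish. This turns a differentiated series back into a power
  series.\<close>

lemma has_sum_shift_multiindex:
  fixes b :: "'a::euclidean_space" and g :: "('a \<Rightarrow> nat) \<Rightarrow> 'b::{topological_comm_monoid_add,t2_space}"
  assumes b: "b \<in> Basis" and g: "(g has_sum s) (Basis \<rightarrow>\<^sub>E UNIV)"
    and 0: "\<And>\<alpha>. \<alpha> b = 0 \<Longrightarrow> g \<alpha> = 0"
  shows "((\<lambda>\<beta>. g (\<beta>(b := Suc (\<beta> b)))) has_sum s) (Basis \<rightarrow>\<^sub>E UNIV)"
proof -
  have "bij_betw (\<lambda>\<beta>. \<beta>(b := Suc (\<beta> b))) (Basis \<rightarrow>\<^sub>E UNIV) {\<alpha> \<in> Basis \<rightarrow>\<^sub>E UNIV. \<alpha> b \<noteq> 0}"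
    by (rule bij_betw_byWitness[where f' = "\<lambda>\<alpha>. \<alpha>(b := \<alpha> b - 1)"])
       (use b in \<open>auto simp: PiE_iff extensional_def\<close>)
  moreover have "(g has_sum s) {\<alpha> \<in> Basis \<rightarrow>\<^sub>E UNIV. \<alpha> b \<noteq> 0}"
    using g by (rule has_sum_cong_neutral[THEN iffD1, rotated -1]) (use 0 in auto)
  ultimately show ?thesis
    by (subst has_sum_reindex_bij_betw[of "\<lambda>\<beta>. \<beta>(b := Suc (\<beta> b))" _ _ g])
qed

lemma countable_multiindices: "countable (Basis \<rightarrow>\<^sub>E UNIV :: ('a::euclidean_space \<Rightarrow> nat) set)"
  by (intro countable_PiE) auto

lemma infinite_multiindices: "infinite (Basis \<rightarrow>\<^sub>E UNIV :: ('a::euclidean_space \<Rightarrow> nat) set)"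
proof
  assume fin: "finite (Basis \<rightarrow>\<^sub>E UNIV :: ('a \<Rightarrow> nat) set)"
  obtain b :: 'a where b: "b \<in> Basis" using nonempty_Basis by blast
  have "UNIV \<subseteq> (\<lambda>\<alpha>. \<alpha> b) ` (Basis \<rightarrow>\<^sub>E UNIV :: ('a \<Rightarrow> nat) set)"
  proof
    fix n :: nat
    show "n \<in> (\<lambda>\<alpha>. \<alpha> b) ` (Basis \<rightarrow>\<^sub>E UNIV)"
      by (rule image_eqI[of _ _ "restrict (\<lambda>_. n) Basis"]) (use b in auto)
  qed
  with fin show False using finite_surj infinite_UNIV_nat by blast
qed

text \<open>Convergence at one corner point is absolute and gives a summable majorant of the
  differentiated terms on a smaller ball. Uniform convergence of the derivatives then justifies
  termwise differentiation, and shifting the multi-indices gives a power series for each directional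
  derivative.\<close>

lemma analytic_derivative_series:
  fixes f :: "'a::euclidean_space \<Rightarrow> real"
  assumes "real_analytic_at f a"
  shows "\<exists>\<delta>>0. \<exists>f'. \<forall>y\<in>ball a \<delta>. (f has_derivative f' y) (at y) \<and>
    (\<forall>v. \<exists>c. \<forall>y\<in>ball a \<delta>.
       ((\<lambda>\<alpha>. (\<Prod>b\<in>Basis. ((y - a) \<bullet> b) ^ \<alpha> b) *\<^sub>R c \<alpha>) has_sum f' y v) (Basis \<rightarrow>\<^sub>E UNIV))"
proof -
  let ?I = "Basis \<rightarrow>\<^sub>E UNIV :: ('a \<Rightarrow> nat) set"
  let ?m = "\<lambda>y \<alpha>. \<Prod>b\<in>Basis. ((y - a) \<bullet> b) ^ \<alpha> b :: real"
  obtain r c where r: "r > 0" and c: "\<And>y. y \<in> ball a r \<Longrightarrow> ((\<lambda>\<alpha>. ?m y \<alpha> * c \<alpha>) has_sum f y) ?I"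
    using assms unfolding real_analytic_at_def real_scaleR_def by blast
  \<comment> \<open>R is small enough that the corner a + R One, all of whose coordinates are offset
    by R, lies in the ball of convergence.\<close>
  define R where "R = r / (2 * (norm (One :: 'a) + 1))"
  have R: "R > 0" using r by (simp add: R_def add_nonneg_pos)
  have "R * norm (One :: 'a) \<le> R * (norm (One :: 'a) + 1)" using R by (intro mult_left_mono) auto
  also have "\<dots> = r / 2" by (simp add: R_def field_simps add_nonneg_eq_0_iff)
  also have "\<dots> < r" using r by simp
  finally have "a + R *\<^sub>R One \<in> ball a r" using R by (simp add: dist_norm)
  from has_sum_imp_summable[OF c[OF this]]
  have "(\<lambda>\<alpha>. ?m (a + R *\<^sub>R One) \<alpha> * c \<alpha>) summable_on ?I" .
  moreover have "?m (a + R *\<^sub>R One) \<alpha> = R ^ (\<Sum>b\<in>Basis. \<alpha> b)" for \<alpha>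
    by (simp add: power_sum cong: prod.cong)
  ultimately have "(\<lambda>\<alpha>. R ^ (\<Sum>b\<in>Basis. \<alpha> b) * c \<alpha>) summable_on ?I"
    by (simp only:)
  then have sumR: "(\<lambda>\<alpha>. \<bar>R ^ (\<Sum>b\<in>Basis. \<alpha> b) * c \<alpha>\<bar>) summable_on ?I"
    using summable_on_iff_abs_summable_on_real by force
  define \<delta> where "\<delta> = R / 2"
  have small: "\<bar>(y - a) \<bullet> b\<bar> \<le> R / 2" if "y \<in> ball a \<delta>" "b \<in> Basis" for y b
    using Basis_le_norm[OF that(2), of "y - a"] that(1)
    by (simp add: \<delta>_def dist_norm norm_minus_commute)
  have \<delta>r: "ball a \<delta> \<subseteq> ball a r"
  proof -
    have "R \<le> r" unfolding R_def using r by (simp add: divide_le_eq mult_le_cancel_left1)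
    then show ?thesis using R by (auto simp: \<delta>_def)
  qed
  have term_bound: "\<bar>c \<alpha> * monom_deriv b \<alpha> (y - a)\<bar> \<le> \<bar>R ^ (\<Sum>b\<in>Basis. \<alpha> b) * c \<alpha>\<bar> * (2 / R)"
    if "y \<in> ball a \<delta>" "b \<in> Basis" for y b \<alpha>
  proof -
    have "\<bar>monom_deriv b \<alpha> (y - a)\<bar> \<le> R ^ (\<Sum>b\<in>Basis. \<alpha> b) * (2 / R)"
      by (rule monom_deriv_bound) (use that R small in auto)
    then have "\<bar>c \<alpha>\<bar> * \<bar>monom_deriv b \<alpha> (y - a)\<bar> \<le> \<bar>c \<alpha>\<bar> * (R ^ (\<Sum>b\<in>Basis. \<alpha> b) * (2 / R))"
      by (rule mult_left_mono) auto
    then show ?thesis using R by (simp add: abs_mult mult_ac)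
  qed
  have term_summable: "(\<lambda>\<alpha>. c \<alpha> * monom_deriv b \<alpha> (y - a)) summable_on ?I"
    if "y \<in> ball a \<delta>" "b \<in> Basis" for y b
  proof -
    have "(\<lambda>\<alpha>. norm (c \<alpha> * monom_deriv b \<alpha> (y - a))) summable_on ?I"
      by (rule summable_on_comparison_test[OF summable_on_cmult_left[OF sumR, of "2 / R"]])
         (use term_bound[OF that] in auto)
    then show ?thesis by (rule summable_on_iff_abs_summable_on_real[THEN iffD2])
  qed
  define D where "D b y = infsum (\<lambda>\<alpha>. c \<alpha> * monom_deriv b \<alpha> (y - a)) ?I" for b y
  define f' where "f' y h = (\<Sum>b\<in>Basis. (h \<bullet> b) * D b y)" for y h
  define t where "t \<alpha> y h = c \<alpha> * (\<Sum>b\<in>Basis. (h \<bullet> b) * monom_deriv b \<alpha> (y - a))" for \<alpha> y h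
  \<comment> \<open>A majorant independent of y; the factor \<open>DIM('a)\<close> counts the
    partial derivatives that are added up.\<close>
  define M where "M \<alpha> = \<bar>R ^ (\<Sum>b\<in>Basis. \<alpha> b) * c \<alpha>\<bar> * (2 / R) * real DIM('a)" for \<alpha>
  have D: "((\<lambda>\<alpha>. c \<alpha> * monom_deriv b \<alpha> (y - a)) has_sum D b y) ?I"
    if "y \<in> ball a \<delta>" "b \<in> Basis" for y b
    unfolding D_def by (rule has_sum_infsum[OF term_summable[OF that]])
  have t: "(\<lambda>\<alpha>. t \<alpha> y h) = (\<lambda>\<alpha>. \<Sum>b\<in>Basis. (h \<bullet> b) * (c \<alpha> * monom_deriv b \<alpha> (y - a)))" for y h
    by (simp add: t_def sum_distrib_left mult_ac)
  have f': "((\<lambda>\<alpha>. t \<alpha> y h) has_sum f' y h) ?I" if "y \<in> ball a \<delta>" for y h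
    unfolding t f'_def by (intro has_sum_finite_sum has_sum_cmult_right D that) auto
  have t_bound: "\<bar>t \<alpha> y h\<bar> \<le> M \<alpha> * norm h" if "y \<in> ball a \<delta>" for \<alpha> y h
  proof -
    have "\<bar>t \<alpha> y h\<bar> \<le> (\<Sum>b\<in>Basis. \<bar>(h \<bullet> b) * (c \<alpha> * monom_deriv b \<alpha> (y - a))\<bar>)"
      unfolding fun_cong[OF t] by (rule sum_abs)
    also have "\<dots> \<le> (\<Sum>b\<in>(Basis :: 'a set). norm h * (\<bar>R ^ (\<Sum>b\<in>Basis. \<alpha> b) * c \<alpha>\<bar> * (2 / R)))"
      by (intro sum_mono, subst abs_mult, intro mult_mono term_bound that Basis_le_norm) auto
    also have "\<dots> = M \<alpha> * norm h" by (simp add: M_def)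
    finally show ?thesis .
  qed
  \<comment> \<open>Multi-indices are enumerated by the naturals so that the theorem on termwise
    differentiation of sequences of functions applies; absolute convergence makes the order
    immaterial.\<close>
  define e where "e = from_nat_into ?I"
  have e: "bij_betw e UNIV ?I"
    unfolding e_def by (rule bij_betw_from_nat_into[OF countable_multiindices infinite_multiindices])
  have sums_e: "(\<lambda>n. g (e n)) sums s" if "(g has_sum s) ?I" for g :: "_ \<Rightarrow> real" and s
    using that by (intro has_sum_imp_sums) (subst has_sum_reindex_bij_betw[OF e])
  have "M summable_on ?I" unfolding M_def by (intro summable_on_cmult_left sumR)
  then have Me: "summable (\<lambda>n. M (e n))"
    using sums_e has_sum_infsum sums_summable by blast
  have M0: "M \<alpha> \<ge> 0" for \<alpha> using R by (simp add: M_def)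
  have "\<exists>g. \<forall>y\<in>ball a \<delta>. (\<lambda>n. ?m y (e n) * c (e n)) sums g y \<and> (g has_derivative f' y) (at y within ball a \<delta>)"
  proof (rule has_derivative_series)
    show "convex (ball a \<delta>)" by simp
    show "((\<lambda>y. ?m y (e n) * c (e n)) has_derivative t (e n) y) (at y within ball a \<delta>)" for n y
      by (rule has_derivative_at_withinI, rule has_derivative_eq_rhs,
          rule has_derivative_mult_left[OF has_derivative_monom])
         (simp add: t_def fun_eq_iff mult.commute)
    show "\<forall>\<^sub>F n in sequentially. \<forall>y\<in>ball a \<delta>. \<forall>h. norm ((\<Sum>i<n. t (e i) y h) - f' y h) \<le> \<epsilon> * norm h"
      if \<epsilon>: "\<epsilon> > 0" for \<epsilon>
    proof -
      obtain N where N: "\<And>n. n \<ge> N \<Longrightarrow> norm (\<Sum>i. M (e (i + n))) < \<epsilon>"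
        using suminf_exist_split[OF \<epsilon> Me] by blast
      have "norm ((\<Sum>i<n. t (e i) y h) - f' y h) \<le> \<epsilon> * norm h" if n: "n \<ge> N" and y: "y \<in> ball a \<delta>" for n y h
      proof -
        have S: "(\<lambda>i. t (e i) y h) sums f' y h" by (rule sums_e[OF f'[OF y]])
        have Mn: "summable (\<lambda>i. M (e (i + n)))" using Me by (rule summable_ignore_initial_segment)
        have "f' y h - (\<Sum>i<n. t (e i) y h) = (\<Sum>i. t (e (i + n)) y h)"
          using suminf_minus_initial_segment[OF sums_summable[OF S], of n] sums_unique[OF S] by simp
        also have "norm \<dots> \<le> (\<Sum>i. M (e (i + n)) * norm h)"
          by (rule norm_suminf_le) (use t_bound[OF y] Mn in \<open>auto intro: summable_mult2\<close>)
        also have "\<dots> = (\<Sum>i. M (e (i + n))) * norm h" by (rule suminf_mult2[OF Mn, symmetric])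
        also have "\<dots> \<le> \<epsilon> * norm h"
          using N[OF n] by (intro mult_right_mono) auto
        finally show ?thesis by (simp add: norm_minus_commute)
      qed
      then show ?thesis unfolding eventually_sequentially by blast
    qed
    show "a \<in> ball a \<delta>" using R by (simp add: \<delta>_def)
    then show "(\<lambda>n. ?m a (e n) * c (e n)) sums f a" using \<delta>r r by (intro sums_e c) auto
  qed
  then obtain g where g: "\<And>y. y \<in> ball a \<delta> \<Longrightarrow> (\<lambda>n. ?m y (e n) * c (e n)) sums g y"
      "\<And>y. y \<in> ball a \<delta> \<Longrightarrow> (g has_derivative f' y) (at y within ball a \<delta>)"
    by blast
  have gf: "g y = f y" if "y \<in> ball a \<delta>" for y
    using sums_unique2[OF g(1)[OF that] sums_e[OF c]] that \<delta>r by auto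
  have der: "(f has_derivative f' y) (at y)" if "y \<in> ball a \<delta>" for y
    using has_derivative_transform_within_open[OF _ open_ball that gf] g(2)[OF that] that
    by (simp add: at_within_open[OF that open_ball])
  \<comment> \<open>The coefficients of the derivative in direction v, after shifting each partial
    derivative down by one in its own exponent.\<close>
  have ser: "((\<lambda>\<alpha>. ?m y \<alpha> *\<^sub>R (\<Sum>b\<in>Basis. (v \<bullet> b) * (real (Suc (\<alpha> b)) * c (\<alpha>(b := Suc (\<alpha> b))))))
      has_sum f' y v) ?I" if "y \<in> ball a \<delta>" for y v
  proof -
    have "((\<lambda>\<alpha>. \<Sum>b\<in>Basis. (v \<bullet> b) * (c (\<alpha>(b := Suc (\<alpha> b))) * monom_deriv b (\<alpha>(b := Suc (\<alpha> b))) (y - a)))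
      has_sum f' y v) ?I"
      unfolding f'_def
      by (intro has_sum_finite_sum has_sum_cmult_right has_sum_shift_multiindex D that)
         (auto simp: monom_deriv_def)
    then show ?thesis
      by (simp add: monom_deriv_Suc sum_distrib_left mult_ac cong: sum.cong)
  qed
  have "\<delta> > 0" using R by (simp add: \<delta>_def)
  show ?thesis
    by (rule exI[of _ \<delta>], rule conjI[OF \<open>\<delta> > 0\<close>], rule exI[of _ f'],
        intro ballI conjI allI, erule der, rule exI, rule ballI, erule ser)
qed

lemma real_analytic_at_derivative:
  fixes f :: "'a::euclidean_space \<Rightarrow> real"
  assumes "real_analytic_at f a"
  shows "f differentiable (at a)" and "real_analytic_at (dirderiv f v) a"
proof -
  obtain \<delta> f' where "\<delta> > 0" and *: "\<forall>y\<in>ball a \<delta>. (f has_derivative f' y) (at y) \<and>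
    (\<forall>v. \<exists>c. \<forall>y\<in>ball a \<delta>.
       ((\<lambda>\<alpha>. (\<Prod>b\<in>Basis. ((y - a) \<bullet> b) ^ \<alpha> b) *\<^sub>R c \<alpha>) has_sum f' y v) (Basis \<rightarrow>\<^sub>E UNIV))"
    using analytic_derivative_series[OF assms] by blast
  have der: "(f has_derivative f' y) (at y)" if "y \<in> ball a \<delta>" for y
    using * that by blast
  from \<open>\<delta> > 0\<close> have a: "a \<in> ball a \<delta>" by simp
  show "f differentiable (at a)" using der[OF a] by (auto simp: differentiable_def)
  obtain c where "\<forall>y\<in>ball a \<delta>.
       ((\<lambda>\<alpha>. (\<Prod>b\<in>Basis. ((y - a) \<bullet> b) ^ \<alpha> b) *\<^sub>R c \<alpha>) has_sum f' y v) (Basis \<rightarrow>\<^sub>E UNIV)"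
    using * a by blast
  then have "\<forall>y\<in>ball a \<delta>.
       ((\<lambda>\<alpha>. (\<Prod>b\<in>Basis. ((y - a) \<bullet> b) ^ \<alpha> b) *\<^sub>R c \<alpha>) has_sum dirderiv f v y) (Basis \<rightarrow>\<^sub>E UNIV)"
    using dirderiv_eqI[OF der] by simp
  then show "real_analytic_at (dirderiv f v) a"
    unfolding real_analytic_at_def using \<open>\<delta> > 0\<close> by blast
qed

lemma real_analytic_smooth:
  fixes f :: "'a::euclidean_space \<Rightarrow> real"
  assumes "real_analytic_on f UNIV"
  shows "smooth f"
proof (rule smooth.coinduct[of "\<lambda>f. real_analytic_on f UNIV", OF assms])
  fix g :: "'a \<Rightarrow> real"
  assume "real_analytic_on g UNIV"
  then have "\<And>x. g differentiable at x" "\<And>v. real_analytic_on (dirderiv g v) UNIV"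
    unfolding real_analytic_on_def by (simp_all add: real_analytic_at_derivative)
  then show "\<exists>h. g = h \<and> (\<forall>x. h differentiable at x) \<and>
      (\<forall>v. real_analytic_on (dirderiv h v) UNIV \<or> smooth (dirderiv h v))"
    by (intro exI[of _ g]) simp
qed

section \<open>Vector-valued analytic functions, treated componentwise\<close>

lemma real_analytic_at_inner:
  fixes f :: "'a::euclidean_space \<Rightarrow> 'b::real_inner"
  assumes "real_analytic_at f a"
  shows "real_analytic_at (\<lambda>x. f x \<bullet> w) a"
proof -
  obtain r c where "r > 0" and c: "\<And>y. y \<in> ball a r \<Longrightarrow>
      ((\<lambda>\<alpha>. (\<Prod>b\<in>Basis. ((y - a) \<bullet> b) ^ \<alpha> b) *\<^sub>R c \<alpha>) has_sum f y) (Basis \<rightarrow>\<^sub>E UNIV)"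
    using assms unfolding real_analytic_at_def by fast
  have "((\<lambda>\<alpha>. (\<Prod>b\<in>Basis. ((y - a) \<bullet> b) ^ \<alpha> b) *\<^sub>R (c \<alpha> \<bullet> w)) has_sum f y \<bullet> w) (Basis \<rightarrow>\<^sub>E UNIV)"
    if "y \<in> ball a r" for y
    using has_sum_bounded_linear[OF bounded_linear_inner_left c[OF that], of w]
    unfolding inner_scaleR_left real_scaleR_def .
  with \<open>r > 0\<close> show ?thesis
    unfolding real_analytic_at_def by (intro exI[of _ r] conjI exI[of _ "\<lambda>\<alpha>. c \<alpha> \<bullet> w"] ballI)
qed

lemma real_analytic_at_isCont:
  fixes f :: "'a::euclidean_space \<Rightarrow> 'b::euclidean_space"
  assumes "real_analytic_at f a"
  shows "isCont f a"
proof -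
  have "isCont (\<lambda>x. f x \<bullet> b) a" for b
    using real_analytic_at_derivative(1)[OF real_analytic_at_inner[OF assms]]
    by (rule differentiable_imp_continuous_within)
  then show ?thesis
    unfolding continuous_at tendsto_componentwise_iff[of f] by blast
qed

subsection \<open>Poisson brackets\<close>

text \<open>The Hamiltonian vector field (dF/dp, -dF/dx): the first slot is the state, the second
  the costate.\<close>

definition hamvec :: "('a::euclidean_space \<times> 'a \<Rightarrow> real) \<Rightarrow> 'a \<times> 'a \<Rightarrow> 'a \<times> 'a" where
  "hamvec F Z = (\<Sum>b\<in>Basis. dirderiv F (0, b) Z *\<^sub>R (b, 0) - dirderiv F (b, 0) Z *\<^sub>R (0, b))"

text \<open>The sign is chosen so that the bracket of F and G is the derivative of G along the
  Hamiltonian field of F.\<close>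

definition poisson ::
    "('a::euclidean_space \<times> 'a \<Rightarrow> real) \<Rightarrow> ('a \<times> 'a \<Rightarrow> real) \<Rightarrow> 'a \<times> 'a \<Rightarrow> real" where
  "poisson F G = (\<lambda>Z. \<Sum>b\<in>Basis. dirderiv F (0, b) Z * dirderiv G (b, 0) Z
                               - dirderiv F (b, 0) Z * dirderiv G (0, b) Z)"

lemma poisson_antisym: "poisson F G Z = - poisson G F Z"
  by (simp add: poisson_def sum_negf[symmetric] mult.commute)

lemma poisson_zero [simp]: "poisson F (\<lambda>_. 0) = (\<lambda>_. 0)"
  by (simp add: poisson_def)

lemma smooth_poisson: "smooth F \<Longrightarrow> smooth G \<Longrightarrow> smooth (poisson F G)"
  unfolding poisson_def by (intro smooth_sum smooth_diff smooth_mult smooth_dirderiv)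

lemma dirderiv_hamvec: "smooth G \<Longrightarrow> dirderiv G (hamvec F Z) Z = poisson F G Z"
  by (simp only: hamvec_def poisson_def linear_sum[OF linear_dirderiv]
      linear_diff[OF linear_dirderiv] linear_scale[OF linear_dirderiv] real_scaleR_def)

text \<open>A derivative in a constant direction commutes with all partial derivatives, so the
  product rule alone makes it a derivation of the bracket.\<close>

lemma dirderiv_poisson:
  assumes F: "smooth F" and G: "smooth G"
  shows "dirderiv (poisson F G) v Z = poisson (dirderiv F v) G Z + poisson F (dirderiv G v) Z"
proof -
  have D: "dirderiv (\<lambda>Z. dirderiv F a Z * dirderiv G b Z) v
      = (\<lambda>Z. dirderiv F a Z * dirderiv (dirderiv G v) b Z + dirderiv (dirderiv F v) a Z * dirderiv G b Z)"
    for a b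
    by (subst dirderiv_mult) (use F G dirderiv_commute[OF F, of _ v] dirderiv_commute[OF G, of _ v]
        in \<open>auto intro: smooth_dirderiv\<close>)
  show ?thesis
    unfolding poisson_def
    by (subst dirderiv_sum, (intro smooth_diff smooth_mult smooth_dirderiv F G),
        subst dirderiv_diff, (intro smooth_mult smooth_dirderiv F G)+)
       (simp add: D sum.distrib[symmetric] sum_subtractf[symmetric] algebra_simps)
qed

text \<open>The vector \<open>hamvec H Z\<close> is evaluated at the point Z and then kept constant.
  The outer bracket becomes a derivative along a fixed vector, and only second derivatives of F and
  G appear.\<close>

lemma poisson_poisson:
  assumes "smooth F" "smooth G"
  shows "poisson H (poisson F G) Z
    = dirderiv (dirderiv G (hamvec H Z)) (hamvec F Z) Z - dirderiv (dirderiv F (hamvec H Z)) (hamvec G Z) Z"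
proof -
  have "poisson H (poisson F G) Z = dirderiv (poisson F G) (hamvec H Z) Z"
    by (simp add: dirderiv_hamvec smooth_poisson assms)
  also have "\<dots> = poisson (dirderiv F (hamvec H Z)) G Z + poisson F (dirderiv G (hamvec H Z)) Z"
    by (rule dirderiv_poisson[OF assms])
  finally show ?thesis
    using poisson_antisym[of "dirderiv F (hamvec H Z)" G Z]
    by (simp add: dirderiv_hamvec smooth_dirderiv assms)
qed

text \<open>After expanding with \<open>poisson_poisson\<close>, every term is a second derivative
  of F, G or H along two Hamiltonian vectors at Z; the terms match by symmetry of second
  derivatives.\<close>

lemma jacobi_identity:
  assumes "smooth F" "smooth G" "smooth H"
  shows "poisson H (poisson F G) Z = poisson (poisson H F) G Z + poisson F (poisson H G) Z"
  unfolding poisson_antisym[of "poisson H F" G] poisson_poisson[OF assms(1,2)]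
    poisson_poisson[OF assms(3,1)] poisson_poisson[OF assms(3,2)]
  using dirderiv_commute[OF assms(1), of "hamvec H Z" "hamvec G Z" Z]
    dirderiv_commute[OF assms(2), of "hamvec H Z" "hamvec F Z" Z]
    dirderiv_commute[OF assms(3), of "hamvec G Z" "hamvec F Z" Z]
  by simp

section \<open>Moving iterated brackets with H between the arguments\<close>

lemma smooth_poisson_power: "smooth H \<Longrightarrow> smooth F \<Longrightarrow> smooth ((poisson H ^^ k) F)"
  by (induction k) (auto intro: smooth_poisson)

text \<open>The Jacobi identity moves one bracket with H from the left argument to the right with a
  change of sign. The error is the bracket of H with an expression of total order below k, which is
  zero.\<close>

lemma poisson_power_shift:
  assumes H: "smooth H" and F: "smooth F" and G: "smooth G"
    and 0: "\<And>l. l < k \<Longrightarrow> poisson F ((poisson H ^^ l) G) = (\<lambda>_. 0)"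
  shows "a + b \<le> k \<Longrightarrow> poisson ((poisson H ^^ a) F) ((poisson H ^^ b) G)
           = (\<lambda>Z. (-1) ^ a * poisson F ((poisson H ^^ (a + b)) G) Z)"
proof (induction a arbitrary: b)
  case 0
  then show ?case by simp
next
  case (Suc a)
  let ?A = "(poisson H ^^ a) F" and ?B = "(poisson H ^^ b) G"
  have IH0: "poisson ?A ?B = (\<lambda>_. 0)"
    using Suc.IH[of b] Suc.prems 0[of "a + b"] by simp
  have "poisson ?A (poisson H ?B) = (\<lambda>Z. (-1) ^ a * poisson F ((poisson H ^^ (Suc a + b)) G) Z)"
    using Suc.IH[of "Suc b"] Suc.prems by simp
  moreover have "poisson (poisson H ?A) ?B Z = - poisson ?A (poisson H ?B) Z" for Z
    using jacobi_identity[OF smooth_poisson_power[OF H F] smooth_poisson_power[OF H G] H, of a b Z]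
    by (simp add: IH0)
  ultimately show ?case by auto
qed

text \<open>Moving all k brackets costs (-1)^k = -1, which cancels the sign from
  antisymmetry.\<close>

lemma poisson_power_symmetric:
  assumes H: "smooth H" and F: "smooth F" and G: "smooth G" and k: "odd k"
    and 0: "\<And>l. l < k \<Longrightarrow> poisson F ((poisson H ^^ l) G) = (\<lambda>_. 0)"
  shows "poisson F ((poisson H ^^ k) G) Z = poisson G ((poisson H ^^ k) F) Z"
proof -
  have "poisson ((poisson H ^^ k) F) ((poisson H ^^ 0) G)
      = (\<lambda>Z. (-1) ^ k * poisson F ((poisson H ^^ (k + 0)) G) Z)"
    by (rule poisson_power_shift[OF H F G 0, of k]) auto
  from fun_cong[OF this, of Z] show ?thesis
    using k poisson_antisym[of "(poisson H ^^ k) F" G Z] by simp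
qed

subsection \<open>The derivatives of the switching function\<close>

definition ham_drift :: "('n::finite, 'm::finite) control_problem \<Rightarrow> 'n aug \<times> 'n aug \<Rightarrow> real" where
  "ham_drift P Z = snd Z \<bullet> aug_drift P (fst Z)"

definition ham_ctrl :: "('n::finite, 'm::finite) control_problem \<Rightarrow> 'm \<Rightarrow> 'n aug \<times> 'n aug \<Rightarrow> real" where
  "ham_ctrl P i Z = snd Z \<bullet> aug_ctrl P i (fst Z)"

text \<open>The drift and control Hamiltonians are linear in the costate with analytic coefficients
  in the state. In coordinates they are finite sums of products of smooth functions.\<close>

lemma smooth_linear_in_costate:
  fixes g0 :: "real^'n \<Rightarrow> real" and g :: "real^'n::finite \<Rightarrow> real^'n"
  assumes "real_analytic_on g0 UNIV" "real_analytic_on g UNIV"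
  shows "smooth (\<lambda>Z :: 'n aug \<times> 'n aug. snd Z \<bullet> (g0 (snd (fst Z)), g (snd (fst Z))))"
proof -
  have lin: "linear (\<lambda>Z :: 'n aug \<times> 'n aug. snd (fst Z))" "linear (\<lambda>Z :: 'n aug \<times> 'n aug. fst (snd Z))"
    "linear (\<lambda>Z :: 'n aug \<times> 'n aug. snd (snd Z) $ i)" for i
    by (auto intro!: linearI)
  have "smooth (\<lambda>x. g x $ i)" for i
    using assms(2) real_analytic_at_inner[of g _ "axis i 1"]
    by (intro real_analytic_smooth) (auto simp: real_analytic_on_def inner_axis)
  moreover have "smooth (\<lambda>Z :: 'n aug \<times> 'n aug. h (snd (fst Z)))" if "smooth h" for h
    using smooth_comp_linear[OF that lin(1)] .
  ultimately have "smooth (\<lambda>Z :: 'n aug \<times> 'n aug.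
      fst (snd Z) * g0 (snd (fst Z)) + (\<Sum>i\<in>UNIV. snd (snd Z) $ i * g (snd (fst Z)) $ i))"
    by (intro smooth_add smooth_mult smooth_sum smooth_linear[OF lin(2)] smooth_linear[OF lin(3)])
       (auto intro: real_analytic_smooth assms)
  then show ?thesis
    by (simp add: inner_prod_def inner_vec_def)
qed

lemma frechet_derivative_vec_lambda:
  fixes f :: "'i::finite \<Rightarrow> 'a::euclidean_space \<Rightarrow> real"
  assumes "\<And>i. smooth (f i)"
  shows "frechet_derivative (\<lambda>x. \<chi> i. f i x) (at x) = (\<lambda>v. \<chi> i. dirderiv (f i) v x)"
proof (rule frechet_derivative_at[symmetric])
  show "((\<lambda>x. \<chi> i. f i x) has_derivative (\<lambda>v. \<chi> i. dirderiv (f i) v x)) (at x)"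
    unfolding has_derivative_componentwise_within[of "\<lambda>x. \<chi> i. f i x"]
    by (auto simp: Basis_vec_def inner_axis intro!: smooth_has_derivative[OF assms])
qed

lemma jacobian_affine: "jacobian (\<lambda>u :: real^'m. a + M *v u) (at 0) = (M :: real^'m^'k)"
proof -
  have "((\<lambda>u. a + M *v u) has_derivative (*v) M) (at 0)"
    using has_derivative_add[OF has_derivative_const linear_imp_has_derivative[OF matrix_vector_mul_linear]]
    by simp
  then show ?thesis
    unfolding jacobian_def by (simp add: frechet_derivative_at[symmetric] matrix_of_matrix_vector_mul)
qed

locale smooth_problem =
  fixes P :: "('n::finite, 'm::finite) control_problem"
  assumes analytic: "analytic_problem P"
begin

lemma smooth_ham_drift: "smooth (ham_drift P)"
  using smooth_linear_in_costate analytic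
  unfolding analytic_problem_def ham_drift_def aug_drift_def by blast

lemma smooth_ham_ctrl: "smooth (ham_ctrl P i)"
  using smooth_linear_in_costate analytic
  unfolding analytic_problem_def ham_ctrl_def aug_ctrl_def by blast

lemma aug_hamiltonian_eq: "aug_hamiltonian P u = (\<lambda>Z. ham_drift P Z + (\<Sum>i\<in>UNIV. ham_ctrl P i Z * u $ i))"
  by (auto simp: aug_hamiltonian_def ham_drift_def ham_ctrl_def)

lemma smooth_aug_hamiltonian: "smooth (aug_hamiltonian P u)"
  unfolding aug_hamiltonian_eq
  by (intro smooth_add smooth_ham_drift smooth_sum smooth_mult smooth_ham_ctrl smooth_const)

lemma dirderiv_aug_hamiltonian:
  "dirderiv (aug_hamiltonian P u) v Z
     = dirderiv (ham_drift P) v Z + (\<Sum>i\<in>UNIV. u $ i * dirderiv (ham_ctrl P i) v Z)"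
proof -
  have "dirderiv (\<lambda>Z. ham_ctrl P i Z * u $ i) v = (\<lambda>Z. u $ i * dirderiv (ham_ctrl P i) v Z)" for i
    by (subst dirderiv_mult) (auto simp: smooth_ham_ctrl)
  then show ?thesis
    by (simp add: aug_hamiltonian_eq dirderiv_add dirderiv_sum smooth_sum smooth_mult smooth_ham_ctrl
        smooth_ham_drift)
qed

lemma hamvec_aug_hamiltonian:
  "hamvec (aug_hamiltonian P u) Z = hamvec (ham_drift P) Z + (\<Sum>i\<in>UNIV. u $ i *\<^sub>R hamvec (ham_ctrl P i) Z)"
proof -
  have split_off: "(a + (\<Sum>i\<in>UNIV. u $ i * d i)) *\<^sub>R v - (a' + (\<Sum>i\<in>UNIV. u $ i * d' i)) *\<^sub>R w
    = (a *\<^sub>R v - a' *\<^sub>R w) + (\<Sum>i\<in>UNIV. u $ i *\<^sub>R (d i *\<^sub>R v - d' i *\<^sub>R w))"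
    for a a' d d' and v w :: "'n aug \<times> 'n aug"
    by (simp add: scaleR_add_left scaleR_sum_left scaleR_diff_right sum_subtractf)
  have "(\<Sum>i\<in>UNIV. u $ i *\<^sub>R hamvec (ham_ctrl P i) Z) =
    (\<Sum>b\<in>Basis. \<Sum>i\<in>UNIV. u $ i *\<^sub>R (dirderiv (ham_ctrl P i) (0, b) Z *\<^sub>R (b, 0) - dirderiv (ham_ctrl P i) (b, 0) Z *\<^sub>R (0, b)))"
    unfolding hamvec_def scaleR_sum_right by (rule sum.swap)
  then show ?thesis
    unfolding hamvec_def[of "aug_hamiltonian P u"] hamvec_def[of "ham_drift P"] dirderiv_aug_hamiltonian
      split_off sum.distrib by (simp only:)
qed

lemma extremal_field_hamvec: "extremal_field P u Z = hamvec (aug_hamiltonian P u) Z"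
proof -
  let ?F = "aug_hamiltonian P u"
  obtain X Q where Z: "Z = (X, Q)" by (cases Z)
  have Q: "dirderiv (\<lambda>Q'. ?F (X, Q')) b Q = dirderiv ?F (0, b) (X, Q)" for b
    by (rule dirderiv_eqI[OF has_derivative_compose[OF _ smooth_has_derivative[OF smooth_aug_hamiltonian]]])
       (auto intro!: derivative_eq_intros)
  have X: "dirderiv (\<lambda>X'. ?F (X', Q)) b X = dirderiv ?F (b, 0) (X, Q)" for b
    by (rule dirderiv_eqI[OF has_derivative_compose[OF _ smooth_has_derivative[OF smooth_aug_hamiltonian]]])
       (auto intro!: derivative_eq_intros)
  show ?thesis
    unfolding Z extremal_field_def gradient_def hamvec_def prod.case dirderiv_def[symmetric] Q X
    by (simp add: prod_eq_iff fst_sum snd_sum sum_negf)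
qed

lemma dirderiv_extremal_field:
  assumes "smooth G"
  shows "dirderiv G (extremal_field P u Z) Z
    = poisson (ham_drift P) G Z + (\<Sum>j\<in>UNIV. u $ j * poisson (ham_ctrl P j) G Z)"
  by (simp add: extremal_field_hamvec hamvec_aug_hamiltonian assms dirderiv_hamvec
      linear_add[OF linear_dirderiv] linear_sum[OF linear_dirderiv] linear_scale[OF linear_dirderiv])

text \<open>With H_0 = \<open>ham_drift P\<close>, this is the k-fold bracket with H_0 applied to
  the control Hamiltonian; it equals the k-th derivative of \<phi>_i as long as no control has
  appeared.\<close>

definition switching_power :: "nat \<Rightarrow> 'm \<Rightarrow> 'n aug \<times> 'n aug \<Rightarrow> real" where
  "switching_power k i = (poisson (ham_drift P) ^^ k) (ham_ctrl P i)"

lemma switching_power_Suc: "switching_power (Suc k) i = poisson (ham_drift P) (switching_power k i)"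
  by (simp add: switching_power_def)

lemma smooth_switching_power: "smooth (switching_power k i)"
  unfolding switching_power_def by (intro smooth_poisson_power smooth_ham_drift smooth_ham_ctrl)

lemma switching_eq: "switching P = (\<lambda>Z. \<chi> i. switching_power 0 i Z)"
  by (auto simp: switching_def switching_power_def ham_ctrl_def)

text \<open>The extremal field is affine in u. Differentiating a function free of u along it gives
  an expression affine in u: the bracket with the drift Hamiltonian is its constant part, the
  brackets with the control Hamiltonians are its coefficients.\<close>

lemma next_switching_deriv:
  assumes "\<And>u. switching_deriv P k u = (\<lambda>Z. \<chi> i. switching_power k i Z)"
  shows "B_coeff P (Suc k) Z $ i $ j = poisson (ham_ctrl P j) (switching_power k i) Z"
    and "A_coeff P (Suc k) Z $ i = switching_power (Suc k) i Z"
    and "switching_deriv P (Suc k) u Z = A_coeff P (Suc k) Z + B_coeff P (Suc k) Z *v u"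
proof -
  let ?M = "\<lambda>Z. \<chi> i j. poisson (ham_ctrl P j) (switching_power k i) Z"
  have S: "switching_deriv P (Suc k) u Z = (\<chi> i. switching_power (Suc k) i Z) + ?M Z *v u" for u Z
    unfolding switching_deriv.simps assms frechet_derivative_vec_lambda[OF smooth_switching_power]
    by (simp add: dirderiv_extremal_field[OF smooth_switching_power] vec_eq_iff matrix_vector_mult_def
        switching_power_Suc mult.commute)
  have B: "B_coeff P (Suc k) Z = ?M Z" for Z
    unfolding B_coeff_def S by (rule jacobian_affine)
  have A: "A_coeff P (Suc k) Z = (\<chi> i. switching_power (Suc k) i Z)" for Z
    unfolding A_coeff_def S by simp
  show "B_coeff P (Suc k) Z $ i $ j = poisson (ham_ctrl P j) (switching_power k i) Z"
    "A_coeff P (Suc k) Z $ i = switching_power (Suc k) i Z"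
    "switching_deriv P (Suc k) u Z = A_coeff P (Suc k) Z + B_coeff P (Suc k) Z *v u"
    by (simp_all add: A B S del: switching_deriv.simps)
qed

lemma switching_deriv_below_order:
  assumes "\<And>j Z. j < N \<Longrightarrow> B_coeff P j Z = 0"
  shows "k < N \<Longrightarrow> switching_deriv P k u = (\<lambda>Z. \<chi> i. switching_power k i Z)"
proof (induction k arbitrary: u)
  case 0
  then show ?case by (simp add: switching_eq)
next
  case (Suc k)
  then have IH: "switching_deriv P k u = (\<lambda>Z. \<chi> i. switching_power k i Z)" for u by simp
  show ?case
    using next_switching_deriv(2,3)[OF IH] assms[OF Suc.prems]
    by (auto simp: vec_eq_iff simp del: switching_deriv.simps)
qed

text \<open>The switching function itself contains no control, so its Jacobian in u is 0 and the
  order cannot be 0.\<close>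

lemma intrinsic_order_pos:
  assumes "intrinsic_order P q"
  shows "q > 0"
proof (rule ccontr)
  assume "\<not> q > 0"
  moreover have "B_coeff P 0 Z = 0" for Z :: "'n aug \<times> 'n aug"
    using jacobian_affine[of "switching P Z" 0] by (simp add: B_coeff_def)
  ultimately show False using assms by (auto simp: intrinsic_order_def)
qed

end

section \<open>Consequences of the intrinsic order: the coefficients as brackets\<close>

locale problem_of_order = smooth_problem P for P :: "('n::finite, 'm::finite) control_problem" +
  fixes q :: nat
  assumes order: "intrinsic_order P q"
begin

lemma q_pos: "q > 0"
  using order by (rule intrinsic_order_pos)

lemma B_vanishes: "j < 2 * q \<Longrightarrow> B_coeff P j Z = 0"
  using order unfolding intrinsic_order_def by blast

lemma switching_deriv_eq: "k < 2 * q \<Longrightarrow> switching_deriv P k u = (\<lambda>Z. \<chi> i. switching_power k i Z)"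
  by (rule switching_deriv_below_order[OF B_vanishes])

lemma B_entries:
  "Suc k \<le> 2 * q \<Longrightarrow> B_coeff P (Suc k) Z $ i $ j = poisson (ham_ctrl P j) (switching_power k i) Z"
  by (rule next_switching_deriv(1)[OF switching_deriv_eq]) simp

lemma A_entries: "A_coeff P (2 * q) Z $ i = switching_power (2 * q) i Z"
  using next_switching_deriv(2)[OF switching_deriv_eq, of "2 * q - 1" Z i] q_pos by simp

lemma poisson_ctrl_switching_power:
  assumes "Suc k < 2 * q"
  shows "poisson (ham_ctrl P j) (switching_power k i) = (\<lambda>_. 0)"
proof
  fix Z :: "'n aug \<times> 'n aug"
  show "poisson (ham_ctrl P j) (switching_power k i) Z = 0"
    using B_entries[where k = k and Z = Z] B_vanishes[OF assms, of Z] assms by force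
qed

text \<open>\<open>{H\<^sub>0, \<cdot>}\<close> is a derivation of the bracket, so it can be moved from one argument of
  \<open>{H\<^sub>j, ad\<^sup>2\<^sup>q\<^sup>-\<^sup>1 H\<^sub>i}\<close> to the other at the price of a sign, the lower brackets being zero.\<close>

lemma B_symmetric: "transpose (B_coeff P (2 * q) Z) = B_coeff P (2 * q) Z"
proof -
  have "B_coeff P (2 * q) Z $ i $ j = B_coeff P (2 * q) Z $ j $ i" for i j
  proof -
    have "poisson (ham_ctrl P j) (switching_power (2 * q - 1) i) Z
        = poisson (ham_ctrl P i) (switching_power (2 * q - 1) j) Z"
      unfolding switching_power_def
      by (rule poisson_power_symmetric[OF smooth_ham_drift smooth_ham_ctrl smooth_ham_ctrl])
         (use q_pos poisson_ctrl_switching_power[unfolded switching_power_def] in auto)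
    then show ?thesis
      using B_entries[where k = "2 * q - 1" and Z = Z] q_pos by simp
  qed
  then show ?thesis by (simp add: transpose_def vec_eq_iff)
qed

end

subsection \<open>The lift of a trajectory\<close>

text \<open>The points of U where two continuous functions differ form an open set. It is a null set
  by assumption, and nonempty open sets are not negligible.\<close>

lemma AE_lebesgue_on_continuous_eq:
  fixes g h :: "real \<Rightarrow> real"
  assumes ae: "AE t in lebesgue_on S. t \<in> U \<longrightarrow> g t = h t" and S: "S \<in> sets lebesgue"
    and U: "open U" "U \<subseteq> S" and g: "continuous_on U g" and h: "continuous_on U h" and t: "t \<in> U"
  shows "g t = h t"
proof (rule ccontr)
  assume "g t \<noteq> h t"
  let ?V = "U \<inter> (\<lambda>t. g t - h t) -` (- {0})"
  have V: "open ?V"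
    by (rule continuous_open_preimage[OF _ U(1)]) (auto intro!: continuous_intros g h)
  moreover have "t \<in> ?V" using t \<open>g t \<noteq> h t\<close> by auto
  ultimately have "\<not> negligible ?V" using open_not_negligible by blast
  moreover have "AE t in lebesgue. t \<notin> ?V"
    using ae S by (subst (asm) AE_restrict_space_iff) (use U in \<open>auto elim!: eventually_mono\<close>)
  then have "?V \<in> null_sets lebesgue"
    by (subst AE_iff_null_sets) (use lborelD[OF borel_open[OF V]] in auto)
  ultimately show False by (simp add: negligible_iff_null_sets)
qed

lemma solves_ae_integrable: "solves_ae T x v \<Longrightarrow> v integrable_on {0..T}"
  by (auto simp: solves_ae_def set_lebesgue_integral_eq_integral(1))

lemma solves_ae_integral: "solves_ae T x v \<Longrightarrow> s \<in> {0..T} \<Longrightarrow> x s = x 0 + integral {0..s} v"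
  using integral_unique[of v "x s - x 0" "{0..s}"] by (simp add: solves_ae_def)

lemma solves_ae_continuous_on:
  assumes "solves_ae T x v"
  shows "continuous_on {0..T} x"
proof -
  have "continuous_on {0..T} (\<lambda>s. x 0 + integral {0..s} v)"
    by (intro continuous_on_add continuous_on_const
        indefinite_integral_continuous_1[OF solves_ae_integrable[OF assms]])
  then show ?thesis
    by (rule continuous_on_eq) (rule solves_ae_integral[OF assms, symmetric])
qed

lemma solves_ae_isCont:
  assumes "solves_ae T x v" "0 < t" "t < T"
  shows "isCont x t"
proof -
  have "continuous_on {0<..<T} x"
    by (rule continuous_on_subset[OF solves_ae_continuous_on[OF assms(1)]]) auto
  then show ?thesis using assms by (simp add: continuous_on_eq_continuous_at)
qed

text \<open>The fundamental theorem of calculus: where the integrand is continuous, a Caratheodory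
  solution is differentiable in the classical sense.\<close>

lemma solves_ae_has_vector_derivative:
  assumes "solves_ae T x v" "0 < t" "t < T" "isCont v t"
  shows "(x has_vector_derivative v t) (at t)"
proof -
  have "((\<lambda>s. integral {0..s} v) has_vector_derivative v t) (at t within {0..T} - {})"
    by (rule integral_has_vector_derivative_continuous_at[OF solves_ae_integrable[OF assms(1)]])
       (use assms in \<open>auto intro: continuous_at_imp_continuous_at_within\<close>)
  then have "((\<lambda>s. integral {0..s} v) has_vector_derivative v t) (at t within {0<..<T})"
    by (rule has_vector_derivative_within_subset) auto
  then have "((\<lambda>s. integral {0..s} v) has_vector_derivative v t) (at t)"
    using at_within_open[of t "{0<..<T}"] assms(2,3) by simp
  then have "((\<lambda>s. x 0 + integral {0..s} v) has_vector_derivative v t) (at t)"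
    by (auto intro!: derivative_eq_intros)
  then show ?thesis
    by (rule has_vector_derivative_transform_within_open[of _ _ _ "{0<..<T}"])
       (use assms(2,3) in \<open>auto intro!: solves_ae_integral[OF assms(1), symmetric]\<close>)
qed

lemma gradient_inner: "gradient (\<lambda>x. x \<bullet> c) z = c"
proof -
  have "frechet_derivative (\<lambda>x. x \<bullet> c) (at z) = (\<lambda>x. x \<bullet> c)"
    by (rule frechet_derivative_at[symmetric]) (auto intro!: derivative_eq_intros)
  then show ?thesis
    by (simp add: gradient_def inner_commute[of _ c] euclidean_representation)
qed

text \<open>The Hamiltonian does not involve the cost coordinate; the zero component is why the
  costate of that coordinate stays constant.\<close>

lemma gradient_snd:
  fixes h :: "'a::euclidean_space \<Rightarrow> real" and X :: "'b::euclidean_space \<times> 'a"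
  assumes "h differentiable (at (snd X))"
  shows "gradient (\<lambda>X. h (snd X)) X = (0, gradient h (snd X))"
proof -
  have "frechet_derivative (\<lambda>X. h (snd X)) (at X) = (\<lambda>v. frechet_derivative h (at (snd X)) (snd v))"
    by (rule frechet_derivative_at[symmetric],
        rule has_derivative_compose[OF has_derivative_snd[OF has_derivative_ident]
          frechet_derivative_works[THEN iffD1, OF assms]])
  moreover have "frechet_derivative h (at (snd X)) 0 = 0"
    using assms by (simp add: linear_0 linear_frechet_derivative)
  ultimately show ?thesis
    by (simp add: gradient_def sum_Basis_prod_eq prod_eq_iff fst_sum snd_sum)
qed

lemma isCont_hamvec: "smooth F \<Longrightarrow> isCont (hamvec F) Z"
  unfolding hamvec_def by (intro continuous_intros smooth_isCont smooth_dirderiv)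

context smooth_problem
begin

lemma aug_hamiltonian_hamiltonian:
  "aug_hamiltonian P w ((c, x), (- l, p)) = hamiltonian P l x p w"
  by (simp add: aug_hamiltonian_def hamiltonian_def dynamics_def running_cost_def aug_drift_def
      aug_ctrl_def inner_add_right inner_sum_right algebra_simps sum.distrib sum_distrib_left sum_negf sum_subtractf)

text \<open>This identifies the augmented Hamiltonian field with the equations for cost, state and
  costate. The zero matches the constant entry -l of the lift.\<close>

lemma extremal_field_components:
  "extremal_field P u ((c, x), (- l, p)) =
    ((running_cost P x u, dynamics P x u), (0, - gradient (\<lambda>x'. hamiltonian P l x' p u) x))"
proof -
  let ?F = "aug_hamiltonian P u"
  have "(\<lambda>Q'. ?F ((c, x), Q')) = (\<lambda>Q'. Q' \<bullet> (running_cost P x u, dynamics P x u))"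
    by (auto simp: aug_hamiltonian_def dynamics_def running_cost_def aug_drift_def
      aug_ctrl_def inner_add_right inner_sum_right algebra_simps sum.distrib sum_distrib_left)
  then have 1: "gradient (\<lambda>Q'. ?F ((c, x), Q')) (- l, p) = (running_cost P x u, dynamics P x u)"
    by (simp only: gradient_inner)
  have "((\<lambda>x'. ?F ((c, x'), (- l, p))) has_derivative (\<lambda>v. dirderiv ?F ((0, v), 0) ((c, x), (- l, p)))) (at x)"
    by (rule has_derivative_compose[OF _ smooth_has_derivative[OF smooth_aug_hamiltonian]])
       (auto intro!: derivative_eq_intros simp: zero_prod_def)
  then have "(\<lambda>x'. hamiltonian P l x' p u) differentiable (at x)"
    unfolding aug_hamiltonian_hamiltonian differentiable_def by blast
  moreover have "(\<lambda>X'. ?F (X', (- l, p))) = (\<lambda>X'. hamiltonian P l (snd X') p u)"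
    by (rule ext, metis aug_hamiltonian_hamiltonian prod.collapse)
  ultimately have 2: "gradient (\<lambda>X'. ?F (X', (- l, p))) (c, x) = (0, gradient (\<lambda>x'. hamiltonian P l x' p u) x)"
    using gradient_snd[of "\<lambda>x'. hamiltonian P l x' p u" "(c, x)"] by simp
  show ?thesis
    by (simp add: extremal_field_def 1 2)
qed

lemma isCont_extremal_field:
  assumes "isCont u t" "isCont Z t"
  shows "isCont (\<lambda>t. extremal_field P (u t) (Z t)) t"
proof -
  have "isCont (\<lambda>t. hamvec F (Z t)) t" if "smooth F" for F
    by (rule isCont_o2[OF assms(2) isCont_hamvec[OF that]])
  then show ?thesis
    unfolding extremal_field_hamvec hamvec_aug_hamiltonian
    by (intro continuous_add continuous_sum continuous_scaleR)
       (auto intro!: smooth_ham_drift smooth_ham_ctrl continuous_intros assms(1))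
qed

end

section \<open>Extremals: regularity of the lift, derivatives of \<phi> along it, and the maximum
  condition\<close>

locale extremal = problem_of_order P q for P :: "('n::finite, 'm::finite) control_problem" and q +
  fixes T l :: real and x p :: "real \<Rightarrow> real^'n" and u :: "real \<Rightarrow> real^'m"
    and Z :: "real \<Rightarrow> 'n aug \<times> 'n aug"
  assumes admissible: "admissible P T x u" and lift: "pmp_lift P T x u l p"
    and Z_eq: "Z = aug_lift P x u l p"
begin

lemma isCont_bound: "t \<ge> 0 \<Longrightarrow> isCont (bound P) t"
  using analytic by (auto simp: analytic_problem_def real_analytic_on_def intro: real_analytic_at_isCont)

lemma bound_pos: "t \<ge> 0 \<Longrightarrow> 0 < bound P t"
  using analytic by (simp add: analytic_problem_def)

lemma abs_control_le: "t \<in> {0..T} \<Longrightarrow> \<bar>u t $ i\<bar> \<le> bound P t"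
  using admissible by (simp add: admissible_def)

lemma x_solves: "solves_ae T x (\<lambda>t. dynamics P (x t) (u t))"
  using admissible by (simp add: admissible_def)

lemma p_solves: "solves_ae T p (\<lambda>t. - gradient (\<lambda>x'. hamiltonian P l x' (p t) (u t)) (x t))"
  using lift by (simp add: pmp_lift_def)

text \<open>This makes the accumulated cost a Caratheodory solution like x and p. The control is
  measurable and bounded, since K is bounded on [0,T], and the cost data are continuous along
  x.\<close>

lemma running_cost_integrable: "(\<lambda>t. running_cost P (x t) (u t)) absolutely_integrable_on {0..T}"
proof -
  have x: "continuous_on {0..T} x" by (rule solves_ae_continuous_on[OF x_solves])
  have cont: "(\<lambda>t. f (x t)) absolutely_integrable_on {0..T}" if "real_analytic_on f UNIV" for f :: "_ \<Rightarrow> real"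
    by (rule absolutely_integrable_continuous_real, rule continuous_on_compose2[OF _ x, of UNIV])
       (auto intro!: continuous_at_imp_continuous_on smooth_isCont real_analytic_smooth that)
  have "bounded (bound P ` {0..T})"
    by (intro compact_imp_bounded compact_continuous_image continuous_at_imp_continuous_on ballI isCont_bound) auto
  then obtain C where C: "\<And>t. t \<in> {0..T} \<Longrightarrow> \<bar>bound P t\<bar> \<le> C"
    unfolding bounded_iff by (metis image_eqI real_norm_def)
  have "(\<lambda>t. u t $ i * cost_ctrl P i (x t)) absolutely_integrable_on {0..T}" for i
  proof (rule absolutely_integrable_bounded_measurable_product_real)
    show "(\<lambda>t. u t $ i) \<in> borel_measurable (lebesgue_on {0..T})"
    proof -
      have "u \<in> borel_measurable (lebesgue_on {0..T})" using admissible by (simp add: admissible_def)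
      moreover have "(\<lambda>v :: real^'m. v $ i) \<in> borel_measurable borel"
        by (intro borel_measurable_continuous_onI continuous_intros)
      ultimately show ?thesis by (rule measurable_compose)
    qed
    show "bounded ((\<lambda>t. u t $ i) ` {0..T})"
    proof -
      have "\<bar>u t $ i\<bar> \<le> C" if "t \<in> {0..T}" for t
        using abs_control_le[OF that, of i] C[OF that] by linarith
      then show ?thesis unfolding bounded_iff by (intro exI[of _ C]) simp
    qed
    show "(\<lambda>t. cost_ctrl P i (x t)) absolutely_integrable_on {0..T}"
      using analytic by (intro cont[of "cost_ctrl P i"]) (simp add: analytic_problem_def)
  qed auto
  then have "(\<lambda>t. \<Sum>i\<in>UNIV. cost_ctrl P i (x t) * u t $ i) absolutely_integrable_on {0..T}"
    by (simp add: mult.commute absolutely_integrable_sum)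
  moreover have "(\<lambda>t. cost_drift P (x t)) absolutely_integrable_on {0..T}"
    using analytic by (intro cont[of "cost_drift P"]) (simp add: analytic_problem_def)
  ultimately show ?thesis
    unfolding running_cost_def by (rule set_integral_add(1)[rotated])
qed

lemma cost_solves: "solves_ae T (accumulated_cost P x u) (\<lambda>t. running_cost P (x t) (u t))"
proof -
  have "(\<lambda>t. running_cost P (x t) (u t)) integrable_on {0..t}" if "t \<le> T" for t
    using set_lebesgue_integral_eq_integral(1)[OF running_cost_integrable]
    by (rule integrable_on_subinterval) (use that in auto)
  then show ?thesis
    using running_cost_integrable by (auto simp: solves_ae_def accumulated_cost_def)
qed

lemma Z_components: "Z = (\<lambda>t. ((accumulated_cost P x u t, x t), (- l, p t)))"
  by (auto simp: Z_eq aug_lift_def)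

lemma isCont_Z: "0 < t \<Longrightarrow> t < T \<Longrightarrow> isCont Z t"
  unfolding Z_components
  by (intro continuous_Pair continuous_const solves_ae_isCont[OF cost_solves] solves_ae_isCont[OF x_solves]
      solves_ae_isCont[OF p_solves])

lemma Z_derivative:
  assumes t: "0 < t" "t < T" and u: "isCont u t"
  shows "(Z has_vector_derivative extremal_field P (u t) (Z t)) (at t)"
proof -
  have c: "isCont (\<lambda>t. extremal_field P (u t) (Z t)) t"
    by (rule isCont_extremal_field[OF u isCont_Z[OF t]])
  have ef: "extremal_field P (u t) (Z t) = ((running_cost P (x t) (u t), dynamics P (x t) (u t)),
      (0, - gradient (\<lambda>x'. hamiltonian P l x' (p t) (u t)) (x t)))" for t
    by (simp add: Z_components extremal_field_components)
  \<comment> \<open>Each right-hand side inherits continuity as a projection of the whole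
    field.\<close>
  have "isCont (\<lambda>t. running_cost P (x t) (u t)) t" "isCont (\<lambda>t. dynamics P (x t) (u t)) t"
    "isCont (\<lambda>t. - gradient (\<lambda>x'. hamiltonian P l x' (p t) (u t)) (x t)) t"
    using isCont_fst[OF isCont_fst[OF c]] isCont_snd[OF isCont_fst[OF c]] isCont_snd[OF isCont_snd[OF c]]
    by (simp_all add: ef)
  then show ?thesis
    unfolding ef unfolding Z_components
    by (intro has_vector_derivative_Pair has_vector_derivative_const
        solves_ae_has_vector_derivative[OF cost_solves t] solves_ae_has_vector_derivative[OF x_solves t]
        solves_ae_has_vector_derivative[OF p_solves t])
qed

lemma smooth_along_Z:
  assumes F: "smooth F" and t: "0 < t" "t < T" and u: "isCont u t"
  shows "((\<lambda>t. F (Z t)) has_real_derivative dirderiv F (extremal_field P (u t) (Z t)) (Z t)) (at t)"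
proof -
  let ?e = "extremal_field P (u t) (Z t)"
  have "((\<lambda>t. F (Z t)) has_derivative (\<lambda>h. dirderiv F (h *\<^sub>R ?e) (Z t))) (at t)"
    using has_derivative_compose[OF Z_derivative[OF t u, unfolded has_vector_derivative_def]
        smooth_has_derivative[OF F]] .
  moreover have "(\<lambda>h. dirderiv F (h *\<^sub>R ?e) (Z t)) = (*) (dirderiv F ?e (Z t))"
    by (auto simp: linear_scale[OF linear_dirderiv[OF F]] mult.commute)
  ultimately show ?thesis by (simp add: has_field_derivative_def)
qed

text \<open>Below the order all coefficients of u in the derivative vanish, so only the bracket with
  the drift Hamiltonian remains.\<close>

lemma switching_power_derivative:
  assumes "0 < t" "t < T" "isCont u t" "Suc k < 2 * q"
  shows "((\<lambda>t. switching_power k i (Z t)) has_real_derivative switching_power (Suc k) i (Z t)) (at t)"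
  using smooth_along_Z[OF smooth_switching_power assms(1-3), of k i]
  by (simp add: dirderiv_extremal_field smooth_switching_power poisson_ctrl_switching_power[OF assms(4)]
      switching_power_Suc)

lemma switching_power_top_derivative:
  assumes "0 < t" "t < T" "isCont u t"
  shows "((\<lambda>t. switching_power (2 * q - 1) i (Z t)) has_real_derivative
          (A_coeff P (2 * q) (Z t) + B_coeff P (2 * q) (Z t) *v u t) $ i) (at t)"
proof -
  have "Suc (2 * q - 1) = 2 * q" using q_pos by simp
  then show ?thesis
    unfolding vector_add_component A_entries
    using smooth_along_Z[OF smooth_switching_power assms, of "2 * q - 1" i]
      B_entries[of "2 * q - 1" "Z t" i] switching_power_Suc[of "2 * q - 1" i]
    by (simp add: dirderiv_extremal_field smooth_switching_power A_entries matrix_vector_mult_def mult.commute)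
qed

lemma isCont_A: "isCont (\<lambda>Z. A_coeff P (2 * q) Z $ i) Y"
  by (simp add: A_entries smooth_isCont smooth_switching_power)

lemma isCont_B: "isCont (\<lambda>Z. B_coeff P (2 * q) Z $ i $ j) Y"
  using B_entries[of "2 * q - 1" _ i j] q_pos
  by (simp add: smooth_isCont smooth_poisson smooth_ham_ctrl smooth_switching_power)

lemma switching_Z: "switching P (Z t) $ i = switching_power 0 i (Z t)"
  by (simp add: switching_eq)

lemma maximum_condition:
  "AE t in lebesgue_on {0..T}. switching P (Z t) $ i * u t $ i = \<bar>switching P (Z t) $ i\<bar> * bound P t"
proof -
  have "AE t in lebesgue_on {0..T}. \<forall>w. (\<forall>i. \<bar>w $ i\<bar> \<le> bound P t) \<longrightarrow>
           hamiltonian P l (x t) (p t) w \<le> hamiltonian P l (x t) (p t) (u t)"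
    using lift by (simp add: pmp_lift_def)
  moreover have "AE t in lebesgue_on {0..T}. t \<in> {0..T}"
    by (rule AE_I2) simp
  ultimately show ?thesis
  proof eventually_elim
    fix t
    assume max: "\<forall>w. (\<forall>i. \<bar>w $ i\<bar> \<le> bound P t) \<longrightarrow>
           hamiltonian P l (x t) (p t) w \<le> hamiltonian P l (x t) (p t) (u t)"
      and t: "t \<in> {0..T}"
    let ?\<phi> = "\<lambda>i. switching P (Z t) $ i"
    \<comment> \<open>The competitor changes only the i-th component, to the value that maximises
      its term; all other terms of the Hamiltonian cancel.\<close>
    define w where "w = (\<chi> j. if j = i then sgn (?\<phi> i) * bound P t else u t $ j)"
    have K: "bound P t > 0" using t bound_pos by simp
    have "\<bar>w $ j\<bar> \<le> bound P t" for j
      using K abs_control_le[OF t, of j] by (auto simp: w_def abs_mult abs_sgn_eq)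
    with max have "hamiltonian P l (x t) (p t) w \<le> hamiltonian P l (x t) (p t) (u t)" by blast
    moreover have "hamiltonian P l (x t) (p t) w = ham_drift P (Z t) + (\<Sum>j\<in>UNIV. ?\<phi> j * w $ j)" for w
      using fun_cong[OF aug_hamiltonian_eq, of w "Z t"]
      by (simp add: switching_eq switching_power_def Z_components aug_hamiltonian_hamiltonian)
    ultimately have "(\<Sum>j\<in>UNIV. ?\<phi> j * w $ j) \<le> (\<Sum>j\<in>UNIV. ?\<phi> j * u t $ j)" by simp
    moreover have "(\<Sum>j\<in>UNIV - {i}. ?\<phi> j * w $ j) = (\<Sum>j\<in>UNIV - {i}. ?\<phi> j * u t $ j)"
      by (rule sum.cong) (auto simp: w_def)
    ultimately have "?\<phi> i * w $ i \<le> ?\<phi> i * u t $ i"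
      by (simp add: sum.remove[of UNIV i])
    moreover have "?\<phi> i * w $ i = \<bar>?\<phi> i\<bar> * bound P t"
      by (simp add: w_def abs_sgn mult.commute mult.left_commute)
    moreover have "?\<phi> i * u t $ i \<le> \<bar>?\<phi> i\<bar> * bound P t"
      using mult_left_mono[OF abs_control_le[OF t, of i], of "\<bar>?\<phi> i\<bar>"]
        abs_ge_self[of "?\<phi> i * u t $ i"] by (simp add: abs_mult)
    ultimately show "?\<phi> i * u t $ i = \<bar>?\<phi> i\<bar> * bound P t" by simp
  qed
qed

end

subsection \<open>Junctions\<close>

text \<open>Move d a little in the direction y = M d. By symmetry the quadratic form changes by 2 e
  |y|^2 plus a term of order e^2, so it would become positive unless y = 0.\<close>

lemma negative_semidefinite_kernel:
  fixes M :: "real^'m^'m"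
  assumes sym: "transpose M = M" and nsd: "negative_semidefinite M" and d: "0 \<le> d \<bullet> (M *v d)"
  shows "M *v d = 0"
proof (rule ccontr)
  define y where "y = M *v d"
  assume "M *v d \<noteq> 0"
  then have y: "0 < y \<bullet> y" by (simp add: y_def)
  define c where "c = y \<bullet> (M *v y)"
  have c: "c \<le> 0" using nsd by (simp add: c_def negative_semidefinite_def)
  \<comment> \<open>With c <= 0 this makes e c > -(y . y), so the second-order term cannot cancel
    the first-order gain.\<close>
  define e where "e = (y \<bullet> y) / (1 - c)"
  have e: "0 < e" using y c by (simp add: e_def)
  have "e * c = (y \<bullet> y) * (c / (1 - c))" by (simp add: e_def)
  also have "\<dots> > (y \<bullet> y) * (- 1)"
    using c y by (intro mult_strict_left_mono) (auto simp: field_simps)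
  finally have ec: "0 < y \<bullet> y + e * c" by simp
  have "d \<bullet> (M *v y) = y \<bullet> y"
    by (metis sym y_def dot_lmul_matrix transpose_matrix_vector)
  then have "(d + e *\<^sub>R y) \<bullet> (M *v (d + e *\<^sub>R y)) = d \<bullet> (M *v d) + e * (y \<bullet> y + (y \<bullet> y + e * c))"
    by (simp add: matrix_vector_right_distrib matrix_vector_mult_scaleR inner_add_left inner_add_right
        c_def y_def[symmetric] algebra_simps)
  moreover have "0 < e * (y \<bullet> y + (y \<bullet> y + e * c))"
    by (intro mult_pos_pos add_pos_pos e y ec)
  ultimately have "0 < (d + e *\<^sub>R y) \<bullet> (M *v (d + e *\<^sub>R y))" using d by simp
  then show False using nsd by (simp add: negative_semidefinite_def not_less[symmetric])
qed

text \<open>This replaces the Taylor expansion: descending from N, a negative derivative and the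
  value 0 at the left end make each lower function strictly decreasing, hence negative.\<close>

lemma iterated_derivative_negative:
  fixes F :: "nat \<Rightarrow> real \<Rightarrow> real"
  assumes cont: "\<And>k. k < N \<Longrightarrow> continuous_on {0..<\<delta>} (F k)" and zero: "\<And>k. k < N \<Longrightarrow> F k 0 = 0"
    and der: "\<And>k s. k < N \<Longrightarrow> 0 < s \<Longrightarrow> s < \<delta> \<Longrightarrow> (F k has_real_derivative F (Suc k) s) (at s)"
    and neg: "\<And>s. 0 < s \<Longrightarrow> s < \<delta> \<Longrightarrow> F N s < 0"
    and "k \<le> N" "0 < s" "s < \<delta>"
  shows "F k s < 0"
  using \<open>k \<le> N\<close> \<open>0 < s\<close> \<open>s < \<delta>\<close>
proof (induction k arbitrary: s rule: inc_induct)
  case base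
  then show ?case by (rule neg)
next
  case (step k)
  have "F k s < F k 0"
  proof (rule DERIV_neg_imp_decreasing_open[OF \<open>0 < s\<close>])
    show "continuous_on {0..s} (F k)"
      by (rule continuous_on_subset[OF cont]) (use step in auto)
    show "\<exists>y. (F k has_real_derivative y) (at r) \<and> y < 0" if "0 < r" "r < s" for r
      using der[of k r] step.IH[of r] step.hyps step.prems that by (intro exI[of _ "F (Suc k) r"]) auto
  qed
  then show ?case using zero step by simp
qed

section \<open>One-sided analysis at a junction\<close>

context extremal
begin

text \<open>Times near the junction are written tc + c s with s > 0; the choice of c = 1 or c = -1
  treats both sides at once.\<close>

lemma tendsto_one_sided:
  assumes "isCont (g :: real \<Rightarrow> 'b::topological_space) tc"
  shows "((\<lambda>s. g (tc + c * s)) \<longlongrightarrow> g tc) (at_right 0)"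
proof -
  have "((\<lambda>s. tc + c * s) \<longlongrightarrow> tc + c * 0) (at_right 0)" by (intro tendsto_intros)
  then show ?thesis using isCont_tendsto_compose[OF assms] by simp
qed

lemma eventually_at_right_interval: "0 < \<delta> \<Longrightarrow> \<forall>\<^sub>F s in at_right (0::real). 0 < s \<and> s < \<delta>"
  by (auto simp: eventually_at_right_field)

lemma isCont_A_Z: "0 < t \<Longrightarrow> t < T \<Longrightarrow> isCont (\<lambda>t. A_coeff P (2 * q) (Z t) $ i) t"
  by (rule isCont_o2[OF isCont_Z isCont_A])

lemma isCont_B_Z: "0 < t \<Longrightarrow> t < T \<Longrightarrow> isCont (\<lambda>t. B_coeff P (2 * q) (Z t) $ i $ j) t"
  by (rule isCont_o2[OF isCont_Z isCont_B])

lemma isCont_switching_power_Z: "0 < t \<Longrightarrow> t < T \<Longrightarrow> isCont (\<lambda>t. switching_power k i (Z t)) t"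
  by (rule isCont_o2[OF isCont_Z smooth_isCont[OF smooth_switching_power]])

lemma has_real_derivative_affine_arg:
  assumes "(g has_real_derivative D) (at (tc + c * s))"
  shows "((\<lambda>s. g (tc + c * s)) has_real_derivative c * D) (at s)"
proof -
  have "((\<lambda>s. tc + c * s) has_real_derivative c) (at s)" by (auto intro!: derivative_eq_intros)
  from DERIV_chain2[OF assms this] show ?thesis by (simp add: mult.commute)
qed

lemma derivative_of_zero:
  fixes g :: "real \<Rightarrow> real"
  assumes zero: "\<And>s. 0 < s \<Longrightarrow> s < \<delta> \<Longrightarrow> g (tc + c * s) = 0" and "c \<noteq> 0"
    and s: "0 < s" "s < \<delta>" and D: "(g has_real_derivative D) (at (tc + c * s))"
  shows "D = 0"
proof -
  have "((\<lambda>_. 0) has_real_derivative c * D) (at s)"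
    by (rule has_field_derivative_transform_within_open[OF has_real_derivative_affine_arg[OF D],
          of "{0<..<\<delta>}"]) (use s zero in auto)
  then show ?thesis
    using DERIV_unique[OF DERIV_const] \<open>c \<noteq> 0\<close> by fastforce
qed

text \<open>All \<phi>_i vanish identically on an open interval, hence so do their derivatives along
  it; the derivative of order 2q is the first one to give an equation for u.\<close>

lemma singular_side:
  assumes tc: "0 < tc - \<delta>" "tc + \<delta> < T" and c: "c \<in> {-1, 1}"
    and u: "\<And>s. 0 < s \<Longrightarrow> s < \<delta> \<Longrightarrow> isCont u (tc + c * s)"
    and sing: "\<And>s i. 0 < s \<Longrightarrow> s < \<delta> \<Longrightarrow> switching P (Z (tc + c * s)) $ i = 0"
    and s: "0 < s" "s < \<delta>"
  shows "k < 2 * q \<Longrightarrow> switching_power k i (Z (tc + c * s)) = 0"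
    and "A_coeff P (2 * q) (Z (tc + c * s)) + B_coeff P (2 * q) (Z (tc + c * s)) *v u (tc + c * s) = 0"
proof -
  have in_T: "0 < tc + c * s" "tc + c * s < T" if "0 < s" "s < \<delta>" for s
    using that tc c by auto
  have c0: "c \<noteq> 0" using c by auto
  have zero: "switching_power k i (Z (tc + c * s)) = 0" if "k < 2 * q" "0 < s" "s < \<delta>" for k i s
    using that
  proof (induction k arbitrary: s)
    case 0
    then show ?case using sing[of s i] by (simp add: switching_Z)
  next
    case (Suc k)
    have D: "((\<lambda>t. switching_power k i (Z t)) has_real_derivative
        switching_power (Suc k) i (Z (tc + c * s))) (at (tc + c * s))"
      using Suc.prems by (intro switching_power_derivative in_T u)
    show ?case
      by (rule derivative_of_zero[OF Suc.IH c0 Suc.prems(2,3) D]) (use Suc.prems in auto)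
  qed
  then show "k < 2 * q \<Longrightarrow> switching_power k i (Z (tc + c * s)) = 0"
    using s by blast
  have "(A_coeff P (2 * q) (Z (tc + c * s)) + B_coeff P (2 * q) (Z (tc + c * s)) *v u (tc + c * s)) $ i = 0" for i
    by (rule derivative_of_zero[OF zero c0 s switching_power_top_derivative[OF in_T[OF s] u[OF s]]])
       (use q_pos in auto)
  then show "A_coeff P (2 * q) (Z (tc + c * s)) + B_coeff P (2 * q) (Z (tc + c * s)) *v u (tc + c * s) = 0"
    by (simp add: vec_eq_iff)
qed

text \<open>The bound on u gives a convergent subsequence of control values as the time tends to tc,
  and A + B u = 0 passes to its limit by continuity of A and B along the lift.\<close>

lemma singular_control_limit:
  assumes \<delta>: "0 < \<delta>" and tc: "0 < tc - \<delta>" "tc + \<delta> < T" and c: "c \<in> {-1, 1}"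
    and u: "\<And>s. 0 < s \<Longrightarrow> s < \<delta> \<Longrightarrow> isCont u (tc + c * s)"
    and sing: "\<And>s i. 0 < s \<Longrightarrow> s < \<delta> \<Longrightarrow> switching P (Z (tc + c * s)) $ i = 0"
  shows "\<exists>us. (\<forall>i. \<bar>us $ i\<bar> \<le> bound P tc) \<and> A_coeff P (2 * q) (Z tc) + B_coeff P (2 * q) (Z tc) *v us = 0"
proof -
  have tcT: "0 < tc" "tc < T" using \<delta> tc by auto
  \<comment> \<open>The double successor keeps the offset strictly below \<delta> even for n =
    0.\<close>
  define t where "t n = tc + c * (\<delta> / real (Suc (Suc n)))" for n
  have small: "0 < \<delta> / real (Suc (Suc n))" "\<delta> / real (Suc (Suc n)) < \<delta>" for n
    using \<delta> by (auto simp: divide_less_eq)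
  have tT: "t n \<in> {0..T}" for n
    using small[of n] tc c by (auto simp: t_def)
  have "(\<lambda>n. inverse (real (Suc (Suc n)))) \<longlonglongrightarrow> 0"
    using LIMSEQ_Suc[OF LIMSEQ_inverse_real_of_nat] .
  then have "t \<longlonglongrightarrow> tc + c * (\<delta> * 0)"
    unfolding t_def divide_inverse by (intro tendsto_intros)
  then have t: "t \<longlonglongrightarrow> tc" by simp
  have K: "(\<lambda>n. bound P (t n)) \<longlonglongrightarrow> bound P tc"
    by (rule isCont_tendsto_compose[OF isCont_bound t]) (use tcT in simp)
  then obtain C where C: "\<And>n. \<bar>bound P (t n)\<bar> \<le> C"
    using convergent_imp_bounded[OF K] by (auto simp: bounded_iff)
  have "norm (u (t n)) \<le> (\<Sum>i\<in>(UNIV :: 'm set). C)" for n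
  proof -
    have "norm (u (t n)) \<le> (\<Sum>i\<in>UNIV. \<bar>u (t n) $ i\<bar>)" by (rule norm_le_l1_cart)
    also have "\<dots> \<le> (\<Sum>i\<in>(UNIV :: 'm set). C)"
    proof (rule sum_mono)
      fix i
      show "\<bar>u (t n) $ i\<bar> \<le> C" using abs_control_le[OF tT, of n i] C[of n] by linarith
    qed
    finally show ?thesis .
  qed
  then have "bounded (range (\<lambda>n. u (t n)))"
    unfolding bounded_iff by blast
  then obtain us r where r: "strict_mono r" and us: "((\<lambda>n. u (t n)) \<circ> r) \<longlonglongrightarrow> us"
    using bounded_imp_convergent_subsequence by blast
  have us_i: "(\<lambda>n. u (t (r n)) $ i) \<longlonglongrightarrow> us $ i" for i
    using tendsto_vec_nth[OF us] by (simp add: o_def)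
  have tr: "(\<lambda>n. t (r n)) \<longlonglongrightarrow> tc"
    using LIMSEQ_subseq_LIMSEQ[OF t r] by (simp add: o_def)
  have "\<bar>us $ i\<bar> \<le> bound P tc" for i
  proof (rule LIMSEQ_le)
    show "(\<lambda>n. \<bar>u (t (r n)) $ i\<bar>) \<longlonglongrightarrow> \<bar>us $ i\<bar>" by (intro tendsto_intros us_i)
    show "(\<lambda>n. bound P (t (r n))) \<longlonglongrightarrow> bound P tc"
      by (rule isCont_tendsto_compose[OF isCont_bound tr]) (use tcT in simp)
    show "\<exists>N. \<forall>n\<ge>N. \<bar>u (t (r n)) $ i\<bar> \<le> bound P (t (r n))" using abs_control_le[OF tT] by blast
  qed
  moreover have "(A_coeff P (2 * q) (Z tc) + B_coeff P (2 * q) (Z tc) *v us) $ i = 0" for i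
  proof -
    have "(\<lambda>n. A_coeff P (2 * q) (Z (t (r n))) $ i + (\<Sum>j\<in>UNIV. B_coeff P (2 * q) (Z (t (r n))) $ i $ j * u (t (r n)) $ j))
      \<longlonglongrightarrow> A_coeff P (2 * q) (Z tc) $ i + (\<Sum>j\<in>UNIV. B_coeff P (2 * q) (Z tc) $ i $ j * us $ j)"
      by (intro tendsto_add tendsto_sum tendsto_mult us_i isCont_tendsto_compose[OF isCont_A_Z[OF tcT] tr]
          isCont_tendsto_compose[OF isCont_B_Z[OF tcT] tr])
    moreover have "A_coeff P (2 * q) (Z (t n)) $ i + (\<Sum>j\<in>UNIV. B_coeff P (2 * q) (Z (t n)) $ i $ j * u (t n) $ j) = 0" for n
      using arg_cong[OF singular_side(2)[OF tc c u sing small], of "\<lambda>v. v $ i" n]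
      by (simp add: t_def matrix_vector_mult_def)
    ultimately show ?thesis
      by (simp add: matrix_vector_mult_def LIMSEQ_const_iff)
  qed
  ultimately show ?thesis by (auto simp: vec_eq_iff)
qed

text \<open>If the limiting top derivative had the wrong sign, it would keep it on a short interval
  by continuity. Since all lower derivatives vanish at tc,
  \<open>iterated_derivative_negative\<close> would give v_i \<phi>_i < 0 there, against
  \<open>sign\<close>.\<close>

lemma nonsingular_side:
  assumes \<delta>: "0 < \<delta>" and tc: "0 < tc - \<delta>" "tc + \<delta> < T" and c: "c \<in> {-1, 1}"
    and u: "\<And>s. 0 < s \<Longrightarrow> s < \<delta> \<Longrightarrow> isCont u (tc + c * s)"
    and v: "v $ i \<in> {-1, 1}"
    and uv: "\<And>s. 0 < s \<Longrightarrow> s < \<delta> \<Longrightarrow> u (tc + c * s) = bound P (tc + c * s) *\<^sub>R v"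
    and sign: "\<And>s. 0 < s \<Longrightarrow> s < \<delta> \<Longrightarrow> 0 \<le> v $ i * switching P (Z (tc + c * s)) $ i"
    and zero: "\<And>k. k < 2 * q \<Longrightarrow> switching_power k i (Z tc) = 0"
  shows "0 \<le> v $ i * (A_coeff P (2 * q) (Z tc) + bound P tc *\<^sub>R (B_coeff P (2 * q) (Z tc) *v v)) $ i"
proof (rule ccontr)
  let ?W = "\<lambda>t. (A_coeff P (2 * q) (Z t) + bound P t *\<^sub>R (B_coeff P (2 * q) (Z t) *v v)) $ i"
  assume "\<not> 0 \<le> v $ i * ?W tc"
  then have neg: "v $ i * ?W tc < 0" by simp
  have tcT: "0 < tc" "tc < T" using \<delta> tc by auto
  have in_T: "0 < tc + c * s" "tc + c * s < T" if "0 \<le> s" "s < \<delta>" for s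
    using that tc c by auto
  have "isCont (\<lambda>t. v $ i * ?W t) tc"
    unfolding vector_add_component vector_scaleR_component matrix_vector_mult_def vec_lambda_beta
    by (intro continuous_intros isCont_A_Z isCont_B_Z isCont_bound tcT) (use tcT in simp)
  from order_tendstoD(2)[OF tendsto_one_sided[OF this, of c] neg]
  obtain \<delta>' where \<delta>': "0 < \<delta>'" "\<And>s. 0 < s \<Longrightarrow> s < \<delta>' \<Longrightarrow> v $ i * ?W (tc + c * s) < 0"
    by (auto simp: eventually_at_right_field)
  \<comment> \<open>Differentiation in s instead of t produces the factor c^k. At level 2q it is 1,
    so both sides of tc yield the same sign condition.\<close>
  define F where "F k s = v $ i * (if k < 2 * q then c ^ k * switching_power k i (Z (tc + c * s)) else ?W (tc + c * s))" for k s
  let ?d = "min \<delta> \<delta>'"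
  have "F 0 s < 0" if "0 < s" "s < ?d" for s
  proof (rule iterated_derivative_negative[where N = "2 * q" and \<delta> = ?d and F = F])
    show "continuous_on {0..<?d} (F k)" if "k < 2 * q" for k
    proof (rule continuous_at_imp_continuous_on, rule ballI)
      fix s assume "s \<in> {0..<?d}"
      then have "isCont (\<lambda>s. switching_power k i (Z (tc + c * s))) s"
        by (intro isCont_o2[OF _ isCont_switching_power_Z] continuous_intros in_T) auto
      then show "isCont (F k) s"
        using that unfolding F_def by (auto intro!: continuous_intros)
    qed
    show "F k 0 = 0" if "k < 2 * q" for k
      using that zero by (simp add: F_def)
    show "(F k has_real_derivative F (Suc k) s) (at s)" if k: "k < 2 * q" and s: "0 < s" "s < ?d" for k s
    proof (cases "Suc k < 2 * q")
      case True
      have "((\<lambda>s. switching_power k i (Z (tc + c * s))) has_real_derivative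
          c * switching_power (Suc k) i (Z (tc + c * s))) (at s)"
        by (rule has_real_derivative_affine_arg, rule switching_power_derivative)
           (use s True in \<open>auto intro: in_T u\<close>)
      from DERIV_cmult[OF DERIV_cmult[OF this, of "c ^ k"], of "v $ i"]
      show ?thesis
        using True by (simp add: F_def[abs_def] mult_ac)
    next
      case False
      with k have k': "k = 2 * q - 1" by simp
      have cc: "c ^ k * c = 1"
      proof -
        have "c ^ k * c = (c ^ 2) ^ q"
          using k' q_pos by (simp add: power_mult[symmetric] power_Suc2[symmetric])
        also have "\<dots> = 1" using c by auto
        finally show ?thesis .
      qed
      have "((\<lambda>s. switching_power k i (Z (tc + c * s))) has_real_derivative c *
          (A_coeff P (2 * q) (Z (tc + c * s)) + B_coeff P (2 * q) (Z (tc + c * s)) *v u (tc + c * s)) $ i) (at s)"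
        unfolding k' by (rule has_real_derivative_affine_arg, rule switching_power_top_derivative)
           (use s in \<open>auto intro: in_T u\<close>)
      then have "((\<lambda>s. switching_power k i (Z (tc + c * s))) has_real_derivative c * ?W (tc + c * s)) (at s)"
        using uv[of s] s by (simp add: matrix_vector_mult_scaleR)
      from DERIV_cmult[OF DERIV_cmult[OF this, of "c ^ k"], of "v $ i"]
      have "((\<lambda>s. v $ i * (c ^ k * switching_power k i (Z (tc + c * s)))) has_real_derivative
          v $ i * ((c ^ k * c) * ?W (tc + c * s))) (at s)" by (simp only: mult.assoc)
      then show ?thesis
        using False k unfolding cc by (simp add: F_def[abs_def])
    qed
    show "F (2 * q) s < 0" if "0 < s" "s < ?d" for s
      using that \<delta>' by (simp add: F_def)
  qed (use that in auto)
  moreover obtain s where "0 < s" "s < ?d" using dense[of 0 ?d] \<delta> \<delta>' by auto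
  ultimately show False
    using sign[of s] q_pos by (auto simp: F_def switching_Z not_less[symmetric])
qed

text \<open>Here c points to the nonsingular side and -c to the singular side. Both sides are
  compared at tc, where symmetry and semidefiniteness of B force the limiting top derivative to
  vanish.\<close>

lemma no_analytic_junction:
  assumes \<delta>: "0 < \<delta>" and tc: "0 < tc - \<delta>" "tc + \<delta> < T" and c: "c \<in> {-1, 1}"
    and u: "\<And>s. 0 < s \<Longrightarrow> s < \<delta> \<Longrightarrow> isCont u (tc + s) \<and> isCont u (tc - s)"
    and sing: "\<And>s i. 0 < s \<Longrightarrow> s < \<delta> \<Longrightarrow> switching P (Z (tc - c * s)) $ i = 0"
    and lc: "\<And>s. 0 < s \<Longrightarrow> s < \<delta> \<Longrightarrow> negative_semidefinite (B_coeff P (2 * q) (Z (tc - c * s)))"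
    and v: "\<And>i. v $ i \<in> {-1, 1}"
    and uv: "\<And>s. 0 < s \<Longrightarrow> s < \<delta> \<Longrightarrow> u (tc + c * s) = bound P (tc + c * s) *\<^sub>R v"
    and sign: "\<And>s i. 0 < s \<Longrightarrow> s < \<delta> \<Longrightarrow> 0 \<le> v $ i * switching P (Z (tc + c * s)) $ i"
  shows "A_coeff P (2 * q) (Z tc) + bound P tc *\<^sub>R (B_coeff P (2 * q) (Z tc) *v v) = 0"
proof -
  let ?A = "A_coeff P (2 * q) (Z tc)" and ?B = "B_coeff P (2 * q) (Z tc)" and ?K = "bound P tc"
  have tcT: "0 < tc" "tc < T" using \<delta> tc by auto
  have c': "- c \<in> {-1, 1}" using c by auto
  have u_sing: "isCont u (tc + - c * s)" and u_nons: "isCont u (tc + c * s)" if "0 < s" "s < \<delta>" for s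
    using u[OF that] c by auto
  have sing': "switching P (Z (tc + - c * s)) $ i = 0" if "0 < s" "s < \<delta>" for s i
    using sing[OF that] by simp
  obtain us where us: "\<And>i. \<bar>us $ i\<bar> \<le> ?K" and Aus: "?A + ?B *v us = 0"
    using singular_control_limit[OF \<delta> tc c' u_sing sing'] by blast
  have zero: "switching_power k i (Z tc) = 0" if "k < 2 * q" for k i
  proof (rule tendsto_unique[OF _ tendsto_one_sided[OF isCont_switching_power_Z[OF tcT], of _ _ "- c"]])
    show "((\<lambda>s. switching_power k i (Z (tc + - c * s))) \<longlongrightarrow> 0) (at_right 0)"
      by (rule tendsto_eventually, rule eventually_mono[OF eventually_at_right_interval[OF \<delta>]])
         (use singular_side(1)[OF tc c' u_sing sing' _ _ that] in blast)
  qed simp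
  \<comment> \<open>The condition is given only at positive distance from tc; for each fixed w the
    quadratic form is continuous and its sign passes to the limit.\<close>
  have nsd: "negative_semidefinite ?B"
    unfolding negative_semidefinite_def
  proof
    fix w :: "real^'m"
    have "isCont (\<lambda>t. w \<bullet> (B_coeff P (2 * q) (Z t) *v w)) tc"
      unfolding inner_vec_def matrix_vector_mult_def vec_lambda_beta inner_real_def
      by (intro continuous_intros isCont_B_Z tcT)
    from tendsto_one_sided[OF this, of "- c"]
    show "w \<bullet> (?B *v w) \<le> 0"
      by (rule tendsto_upperbound, intro eventually_mono[OF eventually_at_right_interval[OF \<delta>]])
         (use lc in \<open>auto simp: negative_semidefinite_def\<close>)
  qed
  define d where "d = ?K *\<^sub>R v - us"
  have w: "?A + ?K *\<^sub>R (?B *v v) = ?B *v d"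
    using Aus by (simp add: d_def matrix_vector_mult_diff_distrib matrix_vector_mult_scaleR eq_neg_iff_add_eq_0)
  \<comment> \<open>The square of v_i is 1, so this product splits into v_i d_i and v_i (B d)_i. The
    first is K - v_i us_i >= 0 by the bound on us, the second is the sign condition from the
    nonsingular side.\<close>
  have "0 \<le> d $ i * (?B *v d) $ i" for i
  proof -
    have vv: "v $ i * v $ i = 1" using v[of i] by auto
    have "0 \<le> v $ i * d $ i"
      using v[of i] us[of i] by (auto simp: d_def)
    moreover have "0 \<le> v $ i * (?B *v d) $ i"
      using nonsingular_side[OF \<delta> tc c u_nons v uv sign zero] unfolding w .
    ultimately have "0 \<le> (v $ i * d $ i) * (v $ i * (?B *v d) $ i)" by (rule mult_nonneg_nonneg)
    also have "\<dots> = (v $ i * v $ i) * (d $ i * (?B *v d) $ i)" by (simp only: mult_ac)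
    finally show ?thesis by (simp only: vv mult_1)
  qed
  then have "0 \<le> d \<bullet> (?B *v d)"
    unfolding inner_vec_def inner_real_def by (rule sum_nonneg)
  then show ?thesis
    unfolding w by (rule negative_semidefinite_kernel[OF B_symmetric nsd])
qed

text \<open>By continuity the maximum condition holds at every point, and |u_i| = K extends from the
  almost everywhere nonzero set of \<phi>_i. A continuous component that never vanishes keeps its
  sign, so one sign vector serves the whole interval.\<close>

lemma bang_bang:
  assumes n: "nonsingular_interval P T Z n1 n2" and U: "{a<..<b} \<subseteq> {n1<..<n2}"
    and u: "\<And>t. t \<in> {a<..<b} \<Longrightarrow> isCont u t" and "a < b"
  obtains v where "\<And>i. v $ i \<in> {-1, 1}" "\<And>t. t \<in> {a<..<b} \<Longrightarrow> u t = bound P t *\<^sub>R v"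
    "\<And>t i. t \<in> {a<..<b} \<Longrightarrow> 0 \<le> v $ i * switching P (Z t) $ i"
proof -
  let ?U = "{a<..<b}" and ?\<phi> = "\<lambda>t i. switching P (Z t) $ i"
  have T: "0 < t" "t < T" if "t \<in> ?U" for t
    using that U n by (force simp: nonsingular_interval_def)+
  have cu: "continuous_on ?U (\<lambda>t. u t $ i)" for i
    by (intro continuous_at_imp_continuous_on ballI continuous_intros u)
  have cK: "continuous_on ?U (bound P)"
    using T by (intro continuous_at_imp_continuous_on ballI isCont_bound) (auto intro: less_imp_le)
  have c\<phi>: "continuous_on ?U (\<lambda>t. ?\<phi> t i)" for i
    unfolding switching_Z
    using T by (intro continuous_at_imp_continuous_on ballI isCont_switching_power_Z) auto
  have max: "?\<phi> t i * u t $ i = \<bar>?\<phi> t i\<bar> * bound P t" if "t \<in> ?U" for t i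
  proof (rule AE_lebesgue_on_continuous_eq[where S = "{0..T}" and U = ?U
        and g = "\<lambda>t. ?\<phi> t i * u t $ i" and h = "\<lambda>t. \<bar>?\<phi> t i\<bar> * bound P t"])
    show "AE t in lebesgue_on {0..T}. t \<in> ?U \<longrightarrow> ?\<phi> t i * u t $ i = \<bar>?\<phi> t i\<bar> * bound P t"
      using maximum_condition[of i] by eventually_elim simp
  qed (use that T in \<open>auto intro!: continuous_intros cu cK c\<phi> simp: less_imp_le\<close>)
  have abs_u: "\<bar>u t $ i\<bar> = bound P t" if "t \<in> ?U" for t i
  proof (rule AE_lebesgue_on_continuous_eq[where S = "{n1<..<n2}" and U = ?U
        and g = "\<lambda>t. \<bar>u t $ i\<bar>" and h = "bound P"])
    have "AE t in lebesgue_on {n1<..<n2}. ?\<phi> t i \<noteq> 0"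
      using n by (simp add: nonsingular_interval_def)
    then show "AE t in lebesgue_on {n1<..<n2}. t \<in> ?U \<longrightarrow> \<bar>u t $ i\<bar> = bound P t"
    proof eventually_elim
      fix t assume 0: "?\<phi> t i \<noteq> 0"
      show "t \<in> ?U \<longrightarrow> \<bar>u t $ i\<bar> = bound P t"
      proof
        assume t: "t \<in> ?U"
        have "\<bar>?\<phi> t i\<bar> * \<bar>u t $ i\<bar> = \<bar>?\<phi> t i\<bar> * bound P t"
          using arg_cong[OF max[OF t, of i], of abs] bound_pos[of t] T[OF t] by (simp add: abs_mult)
        then show "\<bar>u t $ i\<bar> = bound P t" using 0 by simp
      qed
    qed
  qed (use that U in \<open>auto intro!: continuous_intros cu cK\<close>)
  have K: "0 < bound P t" if "t \<in> ?U" for t using T[OF that] bound_pos by simp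
  define m where "m = (a + b) / 2"
  have m: "m \<in> ?U" using \<open>a < b\<close> by (auto simp: m_def)
  define v :: "real^'m" where "v = (\<chi> i. sgn (u m $ i))"
  have v: "v $ i \<in> {-1, 1}" for i
    using abs_u[OF m, of i] K[OF m] by (auto simp: v_def sgn_if)
  have uv: "u t $ i = bound P t * v $ i" if t: "t \<in> ?U" for t i
  proof -
    \<comment> \<open>A change of sign between t and the midpoint m would put 0 into the connected
      image.\<close>
    have "connected ((\<lambda>t. u t $ i) ` ?U)"
      by (rule connected_continuous_image[OF cu]) simp
    then have "{u t $ i..u m $ i} \<subseteq> (\<lambda>t. u t $ i) ` ?U" "{u m $ i..u t $ i} \<subseteq> (\<lambda>t. u t $ i) ` ?U"
      using t m by (simp_all add: connected_contains_Icc)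
    moreover have "0 \<notin> (\<lambda>t. u t $ i) ` ?U"
      using abs_u[of _ i] K by force
    ultimately have "\<not> (u t $ i \<le> 0 \<and> 0 \<le> u m $ i)" "\<not> (u m $ i \<le> 0 \<and> 0 \<le> u t $ i)"
      by (meson atLeastAtMost_iff subsetD)+
    then show ?thesis
      using abs_u[OF t, of i] K[OF t] by (auto simp: v_def sgn_if abs_if split: if_splits)
  qed
  show thesis
  proof
    show "v $ i \<in> {-1, 1}" for i by (rule v)
    show "u t = bound P t *\<^sub>R v" if "t \<in> ?U" for t
      using uv[OF that] by (simp add: vec_eq_iff)
    show "0 \<le> v $ i * ?\<phi> t i" if "t \<in> ?U" for t i
    proof -
      have "bound P t * (v $ i * ?\<phi> t i) = \<bar>?\<phi> t i\<bar> * bound P t"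
        using max[OF that, of i] uv[OF that, of i] by (simp add: mult_ac)
      then have "0 \<le> bound P t * (v $ i * ?\<phi> t i)" using K[OF that] by simp
      then show ?thesis using K[OF that] by (metis mult_zero_right mult_le_cancel_left_pos)
    qed
  qed
qed

text \<open>On an overlap every \<phi>_i would be both zero and almost everywhere nonzero, yet the
  overlap is open and hence of positive measure if nonempty.\<close>

lemma singular_nonsingular_disjoint:
  assumes s: "singular_interval P T Z s1 s2" and n: "nonsingular_interval P T Z n1 n2"
  shows "{s1<..<s2} \<inter> {n1<..<n2} = {}"
proof (rule ccontr)
  assume "{s1<..<s2} \<inter> {n1<..<n2} \<noteq> {}"
  then obtain t where t: "t \<in> {s1<..<s2} \<inter> {n1<..<n2}" by blast
  fix i :: 'm
  \<comment> \<open>The contradictory almost everywhere statement is coded as equality of two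
    constant functions, so that the lemma on continuous functions applies.\<close>
  have "(0::real) = 1"
  proof (rule AE_lebesgue_on_continuous_eq[where S = "{n1<..<n2}" and U = "{s1<..<s2} \<inter> {n1<..<n2}"
        and g = "\<lambda>_. 0" and h = "\<lambda>_. 1"])
    have "AE t in lebesgue_on {n1<..<n2}. switching P (Z t) $ i \<noteq> 0"
      using n by (simp add: nonsingular_interval_def)
    then show "AE t in lebesgue_on {n1<..<n2}. t \<in> {s1<..<s2} \<inter> {n1<..<n2} \<longrightarrow> (0::real) = 1"
      by eventually_elim (use s in \<open>auto simp: singular_interval_def\<close>)
  qed (use t in auto)
  then show False by simp
qed

end

section \<open>Orientation of the two arcs and conclusion\<close>

theorem mainTheorem2:
  fixes P :: "('n::finite, 'm::finite) control_problem"
    and T l tc s1 s2 n1 n2 :: real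
    and x p :: "real \<Rightarrow> real^'n"
    and u :: "real \<Rightarrow> real^'m"
    and q :: nat
    and Z :: "real \<Rightarrow> 'n aug \<times> 'n aug"
  assumes "analytic_problem P"
    and "optimal P T x u"
    and "pmp_lift P T x u l p"
    and "intrinsic_order P q"
    and Z_def: "Z = aug_lift P x u l p"
    and "legendre_clebsch P q T Z"
    and "junction P T Z s1 s2 n1 n2 tc"
    and "\<forall>\<^sub>F t in nhds tc. invertible (B_coeff P (2 * q) (Z t))"
    and "\<forall>t\<in>{s1<..<s2}. \<forall>i. \<bar>u t $ i\<bar> < bound P t"
    and "even q"
    and "\<forall>v. (\<forall>i. v $ i \<in> {-1, 1}) \<longrightarrow>
           A_coeff P (2 * q) (Z tc) + bound P tc *\<^sub>R (B_coeff P (2 * q) (Z tc) *v v) \<noteq> 0"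
  shows "\<not> analytic_junction T u tc"
proof
  assume "analytic_junction T u tc"
  then obtain a b where ab: "0 \<le> a" "tc \<in> {a<..<b}" "b \<le> T" and "piecewise_analytic u a b"
    unfolding analytic_junction_def by auto
  then obtain t1 t2 where t12: "t1 \<in> {a<..<tc}" "t2 \<in> {tc<..<b}"
    and left: "real_analytic_on u {t1<..<tc}" and right: "real_analytic_on u {tc<..<t2}"
    unfolding piecewise_analytic_def by blast
  have t1: "0 < t1" "t1 < tc" and t2: "tc < t2" "t2 < T"
    using ab t12 by auto
  have u: "isCont u t" if "t \<in> {t1<..<tc} \<union> {tc<..<t2}" for t
    using left right that real_analytic_at_isCont unfolding real_analytic_on_def by blast
  interpret extremal P q T l x p u Z
    using assms(1-5) by unfold_locales (simp_all add: optimal_def)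
  have sing: "singular_interval P T Z s1 s2" and nons: "nonsingular_interval P T Z n1 n2"
    and ends: "tc \<in> {s1, s2}" "tc \<in> {n1, n2}"
    using assms(7) by (simp_all add: junction_def)
  have s12: "s1 < s2" and n12: "n1 < n2"
    using sing nons by (simp_all add: singular_interval_def nonsingular_interval_def)
  \<comment> \<open>Both orientations are handled together: c = 1 when the nonsingular arc follows
    tc, c = -1 when it precedes tc.\<close>
  have contradiction: False
    if c: "c \<in> {-1, 1}" and d: "0 < d"
      and in_s: "\<And>s. 0 < s \<Longrightarrow> s < d \<Longrightarrow> tc - c * s \<in> {s1<..<s2}"
      and in_n: "\<And>s. 0 < s \<Longrightarrow> s < d \<Longrightarrow> tc + c * s \<in> {n1<..<n2}" for c d
  proof -
    \<comment> \<open>This stays within both arcs and within the two intervals on which u is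
      analytic.\<close>
    define \<delta> where "\<delta> = min d (min (tc - t1) (t2 - tc))"
    have \<delta>: "0 < \<delta>" "\<delta> \<le> d" "0 < tc - \<delta>" "tc + \<delta> < T"
      using d t1 t2 by (auto simp: \<delta>_def)
    have u': "isCont u (tc + s)" "isCont u (tc - s)" if "0 < s" "s < \<delta>" for s
      using that by (auto intro!: u simp: \<delta>_def)
    let ?U = "{min tc (tc + c * \<delta>)<..<max tc (tc + c * \<delta>)}"
    have U: "t \<in> ?U \<longleftrightarrow> (\<exists>s. 0 < s \<and> s < \<delta> \<and> t = tc + c * s)" for t
    proof
      assume "t \<in> ?U"
      then show "\<exists>s. 0 < s \<and> s < \<delta> \<and> t = tc + c * s"
        \<comment> \<open>As c is its own inverse, s = c (t - tc) solves t = tc + c s.\<close>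
        using c \<delta> by (intro exI[of _ "c * (t - tc)"]) auto
    qed (use c in auto)
    obtain v where v: "\<And>i. v $ i \<in> {-1, 1}" and uv: "\<And>t. t \<in> ?U \<Longrightarrow> u t = bound P t *\<^sub>R v"
      and sign: "\<And>t i. t \<in> ?U \<Longrightarrow> 0 \<le> v $ i * switching P (Z t) $ i"
    proof (rule bang_bang[OF nons])
      show "?U \<subseteq> {n1<..<n2}" using in_n \<delta>(2) U by fastforce
      show "isCont u t" if "t \<in> ?U" for t
        using that u' c unfolding U by auto
      show "min tc (tc + c * \<delta>) < max tc (tc + c * \<delta>)" using c \<delta>(1) by auto
    qed blast
    have "A_coeff P (2 * q) (Z tc) + bound P tc *\<^sub>R (B_coeff P (2 * q) (Z tc) *v v) = 0"
    proof (rule no_analytic_junction[OF \<delta>(1,3,4) c])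
      show "isCont u (tc + s) \<and> isCont u (tc - s)" if "0 < s" "s < \<delta>" for s
        using u'[OF that] by simp
      show "switching P (Z (tc - c * s)) $ i = 0" if "0 < s" "s < \<delta>" for s i
        using sing in_s[of s] that \<delta>(2) by (simp add: singular_interval_def)
      show "negative_semidefinite (B_coeff P (2 * q) (Z (tc - c * s)))" if "0 < s" "s < \<delta>" for s
      proof -
        \<comment> \<open>Evenness of q enters here: the sign (-1)^q is 1, so B itself is negative
          semidefinite.\<close>
        have "negative_semidefinite ((-1) ^ q *\<^sub>R B_coeff P (2 * q) (Z (tc - c * s)))"
          using assms(6) sing in_s[of s] that \<delta>(2) unfolding legendre_clebsch_def by force
        then show ?thesis using \<open>even q\<close> by simp
      qed
      show "u (tc + c * s) = bound P (tc + c * s) *\<^sub>R v" if "0 < s" "s < \<delta>" for s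
        using that U by (intro uv) blast
      show "0 \<le> v $ i * switching P (Z (tc + c * s)) $ i" if "0 < s" "s < \<delta>" for s i
        using that U by (intro sign) blast
    qed (rule v)
    then show False using assms(11) v by blast
  qed
  have disjoint: "\<not> (r \<in> {s1<..<s2} \<and> r \<in> {n1<..<n2})" for r
    using singular_nonsingular_disjoint[OF sing nons] by blast
  \<comment> \<open>In the last two cases both intervals lie on the same side of tc and would
    overlap, which \<open>disjoint\<close> excludes.\<close>
  consider "tc = s2" "tc = n1" | "tc = s1" "tc = n2" | "tc = s1" "tc = n1" | "tc = s2" "tc = n2"
    using ends by auto
  then show False
  proof cases
    case 1
    then show False
      using contradiction[of 1 "min (s2 - s1) (n2 - n1)"] s12 n12 by simp
  next
    case 2
    then show False
      using contradiction[of "-1" "min (s2 - s1) (n2 - n1)"] s12 n12 by simp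
  next
    case 3
    obtain r where "tc < r" "r < min s2 n2" using dense[of tc "min s2 n2"] 3 s12 n12 by auto
    then show False using disjoint[of r] 3 by simp
  next
    case 4
    obtain r where "max s1 n1 < r" "r < tc" using dense[of "max s1 n1" tc] 4 s12 n12 by auto
    then show False using disjoint[of r] 4 by simp
  qed
qed

end
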